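(* (Brouwer's fixed-point theorem.) In the topos $\mathcal{T}_\mu$, every map $I^{\mathbb{N}}\to I^{\mathbb{N}}$ has a fixed point. Moreover, for every $n\in\mathbb{N}$, every map $I^n\to I^n$ has a fixed point. Here $I=[0,1]\subseteq\mathbb{R}_d$.
   Context: Oracle computability. For $\alpha\in2^{\mathbb{N}}$ let $\varphi^\alpha_m$ enumerate the partial $\alpha$-computable functions $\mathbb{N}\rightharpoonup\mathbb{N}$, with indices independent of $\alpha$. Fix computable bijections $\langle\cdot,\cdot\rangle:\mathbb{N}^2\to\mathbb{N}$ and $n\mapsto q_n:\mathbb{N}\to\mathbb{Q}$. A function $g$ represents $x\in\mathbb{R}$ if $|x-q_{g(n)}|<2^{-n}$ for all $n$. Let $r(\alpha)=\sum_i\alpha(i)2^{-i-1}$ and $s(\alpha)(n)=r(m\mapsto\alpha(\langle n,m\rangle))$. For $a:\mathbb{N}\to[0,1]$, $n$ is an $a$-index if a single $x$ is represented by a total $\varphi^\alpha_n$ for all $\alpha\in s^{-1}(a)$. Fix a Miller sequence $\mu:\mathbb{N}\to[0,1]$: every $\mu$-index $n$ represents $\mu(n)$. Put $M_\mu=s^{-1}(\mu)$. A ppca $(A,P)$ is a set $A$, a nonempty set $P$, and partial applications $a\cdot_pb$ such that there are $k,s\in A$ with, for all $p,q,a,b,c$: - $k\cdot_pa=k\cdot_qa$; - $(k\cdot_pa)\cdot_pb=a$; - $s\cdot_pa=s\cdot_qa$; - $(s\cdot_pa)\cdot_pb=(s\cdot_qa)\cdot_qb$ (all these defined); - $((s\cdot_pa)\cdot_pb)\cdot_pc\simeq(a\cdot_pc)\cdot_p(b\cdot_pc)$.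 Its tripos sends $X$ to $\mathcal{P}(A)^X$, with $\phi\le\psi$ iff some $a$ satisfies $a\cdot_pb\in\psi(x)$ for all $x$, $b\in\phi(x)$ and $p\in P$. The logical operations are: - $\top=A$ and $\bot=\emptyset$; - conjunction is realized by pairs whose components lie in each conjunct for every $p$; - disjunction uses pairs tagged with booleans; - $(\phi\to\psi)(x)=\{a\mid\forall p\,\forall b\in\phi(x):a\cdot_pb\in\psi(x)\}$; - $(\exists_r\phi)(x)=\bigcup_{r(y)=x}\phi(y)$; - $(\forall_r\phi)(x)=\{a\mid\forall y(r(y)=x\Rightarrow\forall b\,\forall q:a\cdot_qb\in\phi(y))\}$. $\mathrm{RT}(A,P)$ is the topos obtained from this tripos by the tripos-to-topos construction. $\mathcal{T}_\mu=\mathrm{RT}(\mathbb{N},M_\mu)$ with $m\cdot_\alpha n=\varphi^\alpha_m(n)$. Statements are interpreted internally. $\mathbb{R}_d$ is the object of Dedekind reals. *)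

theory Defs
  imports Complex_Main
begin

section \<open>Oracle computability\<close>

text \<open>
  Kleene's partial recursive functions with an additional basic function, the characteristic
  function of the oracle. Arguments are passed as lists, and the head of the list is the
  recursion argument of \<open>PRec\<close> and the search argument of \<open>Mu\<close>.
\<close>

datatype prog =
    Zero
  | Succ
  | Proj nat
  | Orc
  | Comp prog "prog list"
  | PRec prog prog
  | Mu prog

definition mu_search :: "(nat \<Rightarrow> nat option) \<Rightarrow> nat option" where
  "mu_search f =
     (if \<exists>n. f n = Some 0 \<and> (\<forall>m<n. f m \<noteq> None)
      then Some (LEAST n. f n = Some 0) else None)"

primrec eval :: "(nat \<Rightarrow> bool) \<Rightarrow> prog \<Rightarrow> nat list \<Rightarrow> nat option" where
  "eval \<alpha> Zero = (\<lambda>xs. Some 0)"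
| "eval \<alpha> Succ = (\<lambda>xs. case xs of [] \<Rightarrow> None | x # _ \<Rightarrow> Some (Suc x))"
| "eval \<alpha> (Proj i) = (\<lambda>xs. if i < length xs then Some (xs ! i) else None)"
| "eval \<alpha> Orc = (\<lambda>xs. case xs of [] \<Rightarrow> None | x # _ \<Rightarrow> Some (of_bool (\<alpha> x)))"
| "eval \<alpha> (Comp f gs) =
     (\<lambda>xs. Option.bind (those (map (\<lambda>h. h xs) (map (eval \<alpha>) gs))) (eval \<alpha> f))"
| "eval \<alpha> (PRec f g) =
     (\<lambda>xs. case xs of [] \<Rightarrow> None
           | n # ys \<Rightarrow> rec_nat (eval \<alpha> f ys) (\<lambda>m r. Option.bind r (\<lambda>v. eval \<alpha> g (m # v # ys))) n)"
| "eval \<alpha> (Mu f) = (\<lambda>xs. mu_search (\<lambda>n. eval \<alpha> f (n # xs)))"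

primrec oracle_free :: "prog \<Rightarrow> bool" where
  "oracle_free Zero = True"
| "oracle_free Succ = True"
| "oracle_free (Proj i) = True"
| "oracle_free Orc = False"
| "oracle_free (Comp f gs) = (oracle_free f \<and> list_all (\<lambda>b. b) (map oracle_free gs))"
| "oracle_free (PRec f g) = (oracle_free f \<and> oracle_free g)"
| "oracle_free (Mu f) = oracle_free f"

definition computable1 :: "(nat \<Rightarrow> nat) \<Rightarrow> bool" where
  "computable1 h \<longleftrightarrow> (\<exists>p. oracle_free p \<and> (\<forall>\<alpha> x. eval \<alpha> p [x] = Some (h x)))"

definition computable2 :: "(nat \<Rightarrow> nat \<Rightarrow> nat) \<Rightarrow> bool" where
  "computable2 h \<longleftrightarrow> (\<exists>p. oracle_free p \<and> (\<forall>\<alpha> x y. eval \<alpha> p [x, y] = Some (h x y)))"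

text \<open>
  Acceptable numberings in the sense of Rogers, uniformly in the oracle: there is a universal
  program, and indices can be computed from parameters (s-m-n), both independently of the oracle.
  In particular \<open>\<phi> \<alpha>\<close> enumerates exactly the partial \<open>\<alpha>\<close>-computable functions; see
  \<open>range_acceptable_numbering\<close> below. All standard enumerations are acceptable.
\<close>

definition acceptable_numbering :: "((nat \<Rightarrow> bool) \<Rightarrow> nat \<Rightarrow> nat \<Rightarrow> nat option) \<Rightarrow> bool" where
  "acceptable_numbering \<phi> \<longleftrightarrow>
     (\<exists>u. \<forall>\<alpha> m n. \<phi> \<alpha> m n = eval \<alpha> u [m, n]) \<and>
     (\<forall>p. \<exists>h. computable1 h \<and> (\<forall>\<alpha> m n. \<phi> \<alpha> (h m) n = eval \<alpha> p [m, n]))"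

definition computable_pairing :: "(nat \<Rightarrow> nat \<Rightarrow> nat) \<Rightarrow> bool" where
  "computable_pairing pr \<longleftrightarrow> bij (\<lambda>(m, n). pr m n) \<and> computable2 pr"

definition computable_rat_enumeration :: "(nat \<Rightarrow> rat) \<Rightarrow> bool" where
  "computable_rat_enumeration q \<longleftrightarrow> bij q \<and>
     (\<exists>a b c. computable1 a \<and> computable1 b \<and> computable1 c \<and>
        (\<forall>n. q n = (of_nat (a n) - of_nat (b n)) / of_nat (Suc (c n))))"


section \<open>Miller sequences\<close>

definition represents :: "(nat \<Rightarrow> rat) \<Rightarrow> (nat \<Rightarrow> nat) \<Rightarrow> real \<Rightarrow> bool" where
  "represents q g x \<longleftrightarrow> (\<forall>n. \<bar>x - of_rat (q (g n))\<bar> < 1 / 2 ^ n)"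

definition real_of_bits :: "(nat \<Rightarrow> bool) \<Rightarrow> real" where
  "real_of_bits \<alpha> = (\<Sum>i. of_bool (\<alpha> i) / 2 ^ (i + 1))"

definition seq_of_bits :: "(nat \<Rightarrow> nat \<Rightarrow> nat) \<Rightarrow> (nat \<Rightarrow> bool) \<Rightarrow> nat \<Rightarrow> real" where
  "seq_of_bits pr \<alpha> n = real_of_bits (\<lambda>m. \<alpha> (pr n m))"

text \<open>The set \<open>s\<^sup>-\<^sup>1(a)\<close>; for a Miller sequence \<open>\<mu>\<close> this is the parameter set \<open>M\<^sub>\<mu>\<close>.\<close>

definition oracles_of :: "(nat \<Rightarrow> nat \<Rightarrow> nat) \<Rightarrow> (nat \<Rightarrow> real) \<Rightarrow> (nat \<Rightarrow> bool) set" where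
  "oracles_of pr a = {\<alpha>. seq_of_bits pr \<alpha> = a}"

definition index_represents ::
  "((nat \<Rightarrow> bool) \<Rightarrow> nat \<Rightarrow> nat \<Rightarrow> nat option) \<Rightarrow> (nat \<Rightarrow> nat \<Rightarrow> nat) \<Rightarrow> (nat \<Rightarrow> rat) \<Rightarrow>
     (nat \<Rightarrow> real) \<Rightarrow> nat \<Rightarrow> real \<Rightarrow> bool" where
  "index_represents \<phi> pr q a n x \<longleftrightarrow>
     (\<forall>\<alpha>\<in>oracles_of pr a. \<exists>g. (\<forall>k. \<phi> \<alpha> n k = Some (g k)) \<and> represents q g x)"

text \<open>
  The number represented by an index is required to lie in \<open>[0,1]\<close>, like the members of the
  sequence. Without this bound there would be no Miller sequences at all: a constant program
  representing \<open>2\<close> would be an index for every sequence.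
\<close>

definition is_index ::
  "((nat \<Rightarrow> bool) \<Rightarrow> nat \<Rightarrow> nat \<Rightarrow> nat option) \<Rightarrow> (nat \<Rightarrow> nat \<Rightarrow> nat) \<Rightarrow> (nat \<Rightarrow> rat) \<Rightarrow>
     (nat \<Rightarrow> real) \<Rightarrow> nat \<Rightarrow> bool" where
  "is_index \<phi> pr q a n \<longleftrightarrow> (\<exists>x\<in>{0..1}. index_represents \<phi> pr q a n x)"

definition miller_sequence ::
  "((nat \<Rightarrow> bool) \<Rightarrow> nat \<Rightarrow> nat \<Rightarrow> nat option) \<Rightarrow> (nat \<Rightarrow> nat \<Rightarrow> nat) \<Rightarrow> (nat \<Rightarrow> rat) \<Rightarrow>
     (nat \<Rightarrow> real) \<Rightarrow> bool" where
  "miller_sequence \<phi> pr q \<mu> \<longleftrightarrow>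
     (\<forall>n. \<mu> n \<in> {0..1}) \<and>
     (\<forall>n. is_index \<phi> pr q \<mu> n \<longrightarrow> index_represents \<phi> pr q \<mu> n (\<mu> n))"


section \<open>Parameterized partial combinatory algebras\<close>

text \<open>
  The underlying set \<open>A\<close> is the whole type \<open>'a\<close>. The combinators are part of the structure because
  the pairs and booleans that realize the connectives are built from them.
\<close>

record ('a, 'p) ppca =
  par :: "'p set"
  app :: "'p \<Rightarrow> 'a \<Rightarrow> 'a \<Rightarrow> 'a option"
  comb_k :: 'a
  comb_s :: 'a

definition oapp :: "('a, 'p) ppca \<Rightarrow> 'p \<Rightarrow> 'a option \<Rightarrow> 'a option \<Rightarrow> 'a option" where
  "oapp T p x y = Option.bind x (\<lambda>a. Option.bind y (\<lambda>b. app T p a b))"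

definition is_ppca :: "('a, 'p) ppca \<Rightarrow> bool" where
  "is_ppca T \<longleftrightarrow> par T \<noteq> {} \<and>
     (\<forall>p\<in>par T. \<forall>p'\<in>par T. \<forall>a b c.
        app T p (comb_k T) a = app T p' (comb_k T) a \<and>
        oapp T p (app T p (comb_k T) a) (Some b) = Some a \<and>
        app T p (comb_s T) a = app T p' (comb_s T) a \<and>
        oapp T p (app T p (comb_s T) a) (Some b) = oapp T p' (app T p' (comb_s T) a) (Some b) \<and>
        oapp T p (app T p (comb_s T) a) (Some b) \<noteq> None \<and>
        oapp T p (oapp T p (app T p (comb_s T) a) (Some b)) (Some c) =
          oapp T p (app T p a c) (app T p b c))"

text \<open>Only used for applications that are defined and do not depend on the parameter.\<close>

definition app0 :: "('a, 'p) ppca \<Rightarrow> 'a \<Rightarrow> 'a \<Rightarrow> 'a" where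
  "app0 T a b = the (app T (SOME p. p \<in> par T) a b)"

definition comb_true :: "('a, 'p) ppca \<Rightarrow> 'a" where
  "comb_true T = comb_k T"

definition comb_false :: "('a, 'p) ppca \<Rightarrow> 'a" where
  "comb_false T = app0 T (comb_k T) (app0 T (app0 T (comb_s T) (comb_k T)) (comb_k T))"

definition app_in :: "('a, 'p) ppca \<Rightarrow> 'p \<Rightarrow> 'a \<Rightarrow> 'a \<Rightarrow> 'a set \<Rightarrow> bool" where
  "app_in T p a b S \<longleftrightarrow> (\<exists>c. app T p a b = Some c \<and> c \<in> S)"


section \<open>The tripos of a ppca\<close>

text \<open>
  A predicate on \<open>X\<close> is a function from \<open>X\<close> to sets of realizers. The propositional connectives act
  pointwise and are therefore given on a single fibre. Pairs are Church pairs
  \<open>\<lambda>z. z a b\<close>, so that the components of \<open>c\<close> at the parameter \<open>p\<close> are the results of applying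
  \<open>c\<close> to the two booleans at \<open>p\<close>.
\<close>

definition tle :: "('a, 'p) ppca \<Rightarrow> ('x \<Rightarrow> 'a set) \<Rightarrow> ('x \<Rightarrow> 'a set) \<Rightarrow> bool" where
  "tle T \<phi> \<psi> \<longleftrightarrow> (\<exists>a. \<forall>x. \<forall>b\<in>\<phi> x. \<forall>p\<in>par T. app_in T p a b (\<psi> x))"

definition rtop :: "'a set" where
  "rtop = UNIV"

definition rbot :: "'a set" where
  "rbot = {}"

definition rand :: "('a, 'p) ppca \<Rightarrow> 'a set \<Rightarrow> 'a set \<Rightarrow> 'a set" where
  "rand T U V =
     {c. \<forall>p\<in>par T. app_in T p c (comb_true T) U \<and> app_in T p c (comb_false T) V}"

definition ror :: "('a, 'p) ppca \<Rightarrow> 'a set \<Rightarrow> 'a set \<Rightarrow> 'a set" where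
  "ror T U V =
     {c. \<forall>p\<in>par T.
        app_in T p c (comb_true T) {comb_true T} \<and> app_in T p c (comb_false T) U \<or>
        app_in T p c (comb_true T) {comb_false T} \<and> app_in T p c (comb_false T) V}"

definition rimp :: "('a, 'p) ppca \<Rightarrow> 'a set \<Rightarrow> 'a set \<Rightarrow> 'a set" where
  "rimp T U V = {a. \<forall>p\<in>par T. \<forall>b\<in>U. app_in T p a b V}"

definition riff :: "('a, 'p) ppca \<Rightarrow> 'a set \<Rightarrow> 'a set \<Rightarrow> 'a set" where
  "riff T U V = rand T (rimp T U V) (rimp T V U)"

definition ex_along :: "('y \<Rightarrow> 'x) \<Rightarrow> ('y \<Rightarrow> 'a set) \<Rightarrow> 'x \<Rightarrow> 'a set" where
  "ex_along r \<phi> x = (\<Union>y\<in>{y. r y = x}. \<phi> y)"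

definition all_along ::
  "('a, 'p) ppca \<Rightarrow> ('y \<Rightarrow> 'x) \<Rightarrow> ('y \<Rightarrow> 'a set) \<Rightarrow> 'x \<Rightarrow> 'a set" where
  "all_along T r \<phi> x = {a. \<forall>y. r y = x \<longrightarrow> (\<forall>b. \<forall>p\<in>par T. app_in T p a b (\<phi> y))}"

text \<open>
  The fibre over \<open>x\<close> of the quantification of \<open>\<phi>\<close> along the projection \<open>X \<times> Y \<rightarrow> X\<close> is the
  quantification of \<open>\<lambda>y. \<phi> (x, y)\<close> along \<open>Y \<rightarrow> 1\<close>.
\<close>

definition rex :: "('y \<Rightarrow> 'a set) \<Rightarrow> 'a set" where
  "rex \<phi> = ex_along (\<lambda>_. ()) \<phi> ()"

definition rall :: "('a, 'p) ppca \<Rightarrow> ('y \<Rightarrow> 'a set) \<Rightarrow> 'a set" where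
  "rall T \<phi> = all_along T (\<lambda>_. ()) \<phi> ()"

text \<open>A relation of the ambient set theory, viewed as a predicate of the tripos.\<close>

definition lift :: "bool \<Rightarrow> 'a set" where
  "lift b = (if b then rtop else rbot)"

definition holds :: "('a, 'p) ppca \<Rightarrow> 'a set \<Rightarrow> bool" where
  "holds T U \<longleftrightarrow> tle T (\<lambda>_::unit. rtop) (\<lambda>_. U)"


section \<open>The topos of a ppca and its internal language\<close>

text \<open>
  The tripos-to-topos construction. An object is a type together with a partial equivalence
  relation in the tripos, the equality of the object; \<open>X x x\<close> says that \<open>x\<close> exists. Arbitrary
  underlying sets are covered, since elements outside of the intended set may be given empty
  existence. Morphisms are (provable equality classes of) functional relations. A formula about
  objects of the topos holds internally iff it holds in the tripos with quantifiers
  relativized to existence.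
\<close>

type_synonym ('a, 'x) tobj = "'x \<Rightarrow> 'x \<Rightarrow> 'a set"

definition is_object :: "('a, 'p) ppca \<Rightarrow> ('a, 'x) tobj \<Rightarrow> bool" where
  "is_object T X \<longleftrightarrow>
     holds T (rand T
       (rall T (\<lambda>x. rall T (\<lambda>y. rimp T (X x y) (X y x))))
       (rall T (\<lambda>x. rall T (\<lambda>y. rall T (\<lambda>z. rimp T (rand T (X x y) (X y z)) (X x z))))))"

definition all_in :: "('a, 'p) ppca \<Rightarrow> ('a, 'x) tobj \<Rightarrow> ('x \<Rightarrow> 'a set) \<Rightarrow> 'a set" where
  "all_in T X \<phi> = rall T (\<lambda>x. rimp T (X x x) (\<phi> x))"

definition ex_in :: "('a, 'p) ppca \<Rightarrow> ('a, 'x) tobj \<Rightarrow> ('x \<Rightarrow> 'a set) \<Rightarrow> 'a set" where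
  "ex_in T X \<phi> = rex (\<lambda>x. rand T (X x x) (\<phi> x))"

definition prod_obj ::
  "('a, 'p) ppca \<Rightarrow> ('a, 'x) tobj \<Rightarrow> ('a, 'y) tobj \<Rightarrow> ('a, 'x \<times> 'y) tobj" where
  "prod_obj T X Y = (\<lambda>(x, y) (x', y'). rand T (X x x') (Y y y'))"

definition sub_obj :: "('a, 'p) ppca \<Rightarrow> ('a, 'x) tobj \<Rightarrow> ('x \<Rightarrow> 'a set) \<Rightarrow> ('a, 'x) tobj" where
  "sub_obj T X \<phi> = (\<lambda>x y. rand T (X x y) (\<phi> x))"

definition strict_extensional ::
  "('a, 'p) ppca \<Rightarrow> ('a, 'x) tobj \<Rightarrow> ('x \<Rightarrow> 'a set) \<Rightarrow> 'a set" where
  "strict_extensional T X R =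
     rand T (rall T (\<lambda>x. rimp T (R x) (X x x)))
            (rall T (\<lambda>x. rall T (\<lambda>y. rimp T (rand T (R x) (X x y)) (R y))))"

definition pow_obj :: "('a, 'p) ppca \<Rightarrow> ('a, 'x) tobj \<Rightarrow> ('a, 'x \<Rightarrow> 'a set) tobj" where
  "pow_obj T X =
     (\<lambda>R S. rand T (strict_extensional T X R) (rall T (\<lambda>x. riff T (R x) (S x))))"

definition single_valued_total ::
  "('a, 'p) ppca \<Rightarrow> ('a, 'x) tobj \<Rightarrow> ('a, 'y) tobj \<Rightarrow> ('x \<times> 'y \<Rightarrow> 'a set) \<Rightarrow> 'a set" where
  "single_valued_total T X Y F =
     rand T
       (all_in T X (\<lambda>x. all_in T Y (\<lambda>y. all_in T Y (\<lambda>y'.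
          rimp T (rand T (F (x, y)) (F (x, y'))) (Y y y')))))
       (all_in T X (\<lambda>x. ex_in T Y (\<lambda>y. F (x, y))))"

text \<open>
  The exponential \<open>Y\<^bsup>X\<^esup>\<close> is the object of functional relations, a subobject of the power object
  of \<open>X \<times> Y\<close>; evaluation sends \<open>(F, x)\<close> to the \<open>y\<close> with \<open>F (x, y)\<close>.
\<close>

definition exp_obj ::
  "('a, 'p) ppca \<Rightarrow> ('a, 'x) tobj \<Rightarrow> ('a, 'y) tobj \<Rightarrow> ('a, 'x \<times> 'y \<Rightarrow> 'a set) tobj" where
  "exp_obj T X Y = sub_obj T (pow_obj T (prod_obj T X Y)) (single_valued_total T X Y)"

definition is_morphism ::
  "('a, 'p) ppca \<Rightarrow> ('a, 'x) tobj \<Rightarrow> ('a, 'y) tobj \<Rightarrow> ('x \<times> 'y \<Rightarrow> 'a set) \<Rightarrow> bool" where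
  "is_morphism T X Y F \<longleftrightarrow> holds T (exp_obj T X Y F F)"

text \<open>Every map from \<open>X\<close> to \<open>X\<close> has a fixed point, where \<open>f(x) = x\<close> is \<open>F (x, x)\<close>.\<close>

definition every_map_has_fixed_point :: "('a, 'p) ppca \<Rightarrow> ('a, 'x) tobj \<Rightarrow> 'a set" where
  "every_map_has_fixed_point T X =
     all_in T (exp_obj T X X) (\<lambda>F. ex_in T X (\<lambda>x. F (x, x)))"


section \<open>Numbers in the topos over the natural numbers\<close>

definition nat_obj :: "(nat, nat) tobj" where
  "nat_obj m n = {k. k = m \<and> m = n}"

text \<open>
  The rationals are realized by their indices in the enumeration; their order is
  decidable, so it agrees with the order of the ambient rationals.
\<close>

definition rat_obj :: "(nat \<Rightarrow> rat) \<Rightarrow> (nat, rat) tobj" where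
  "rat_obj q x y = {k. q k = x \<and> x = y}"

text \<open>The object \<open>{k \<in> \<nat> | k < n}\<close>.\<close>

definition below_obj :: "(nat, 'p) ppca \<Rightarrow> nat \<Rightarrow> (nat, nat) tobj" where
  "below_obj T n = sub_obj T nat_obj (\<lambda>k. lift (k < n))"

definition dedekind_cut ::
  "(nat, 'p) ppca \<Rightarrow> (nat \<Rightarrow> rat) \<Rightarrow> (rat \<Rightarrow> nat set) \<times> (rat \<Rightarrow> nat set) \<Rightarrow> nat set" where
  "dedekind_cut T q = (\<lambda>(L, U).
     rand T (ex_in T (rat_obj q) L)
    (rand T (ex_in T (rat_obj q) U)
    (rand T (all_in T (rat_obj q) (\<lambda>x.
               riff T (L x) (ex_in T (rat_obj q) (\<lambda>y. rand T (lift (x < y)) (L y)))))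
    (rand T (all_in T (rat_obj q) (\<lambda>y.
               riff T (U y) (ex_in T (rat_obj q) (\<lambda>x. rand T (lift (x < y)) (U x)))))
    (rand T (all_in T (rat_obj q) (\<lambda>x. rimp T (rand T (L x) (U x)) rbot))
            (all_in T (rat_obj q) (\<lambda>x. all_in T (rat_obj q) (\<lambda>y.
               rimp T (lift (x < y)) (ror T (L x) (U y))))))))))"

definition real_obj ::
  "(nat, 'p) ppca \<Rightarrow> (nat \<Rightarrow> rat) \<Rightarrow> (nat, (rat \<Rightarrow> nat set) \<times> (rat \<Rightarrow> nat set)) tobj" where
  "real_obj T q =
     sub_obj T (prod_obj T (pow_obj T (rat_obj q)) (pow_obj T (rat_obj q))) (dedekind_cut T q)"

text \<open>The cut of a rational; the existence of the argument makes both halves strict.\<close>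

definition rat_cut ::
  "(nat, 'p) ppca \<Rightarrow> (nat \<Rightarrow> rat) \<Rightarrow> rat \<Rightarrow> (rat \<Rightarrow> nat set) \<times> (rat \<Rightarrow> nat set)" where
  "rat_cut T q r =
     (\<lambda>x. rand T (rat_obj q x x) (lift (x < r)), \<lambda>x. rand T (rat_obj q x x) (lift (r < x)))"

definition real_le ::
  "(nat, 'p) ppca \<Rightarrow> (nat \<Rightarrow> rat) \<Rightarrow> (rat \<Rightarrow> nat set) \<times> (rat \<Rightarrow> nat set) \<Rightarrow>
     (rat \<Rightarrow> nat set) \<times> (rat \<Rightarrow> nat set) \<Rightarrow> nat set" where
  "real_le T q x y =
     rand T (all_in T (rat_obj q) (\<lambda>r. rimp T (fst x r) (fst y r)))
            (all_in T (rat_obj q) (\<lambda>r. rimp T (snd y r) (snd x r)))"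

definition unit_interval_obj ::
  "(nat, 'p) ppca \<Rightarrow> (nat \<Rightarrow> rat) \<Rightarrow> (nat, (rat \<Rightarrow> nat set) \<times> (rat \<Rightarrow> nat set)) tobj" where
  "unit_interval_obj T q =
     sub_obj T (real_obj T q)
       (\<lambda>x. rand T (real_le T q (rat_cut T q 0) x) (real_le T q x (rat_cut T q 1)))"


section \<open>Oracle computation forms a ppca\<close>

lemma eval_Comp1 [simp]:
  "eval \<alpha> (Comp f [g]) xs = Option.bind (eval \<alpha> g xs) (\<lambda>a. eval \<alpha> f [a])"
  by (cases "eval \<alpha> g xs") auto

lemma eval_Comp2 [simp]:
  "eval \<alpha> (Comp f [g, h]) xs =
     Option.bind (eval \<alpha> g xs) (\<lambda>a. Option.bind (eval \<alpha> h xs) (\<lambda>b. eval \<alpha> f [a, b]))"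
  by (cases "eval \<alpha> g xs"; cases "eval \<alpha> h xs") auto

primrec const_prog :: "nat \<Rightarrow> prog" where
  "const_prog 0 = Zero"
| "const_prog (Suc n) = Comp Succ [const_prog n]"

lemma eval_const_prog [simp]: "eval \<alpha> (const_prog n) xs = Some n"
  by (induction n) (simp_all del: eval.simps(5))

lemma range_acceptable_numbering:
  assumes "acceptable_numbering \<phi>"
  shows "range (\<phi> \<alpha>) = {f. \<exists>p. \<forall>n. f n = eval \<alpha> p [n]}"
proof (intro equalityI subsetI)
  fix f assume "f \<in> range (\<phi> \<alpha>)"
  then obtain m where f: "f = \<phi> \<alpha> m" by blast
  obtain u where "\<And>\<alpha> m n. \<phi> \<alpha> m n = eval \<alpha> u [m, n]"
    using assms unfolding acceptable_numbering_def by blast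
  then have "f n = eval \<alpha> (Comp u [const_prog m, Proj 0]) [n]" for n
    by (simp add: f del: eval.simps(5))
  then show "f \<in> {f. \<exists>p. \<forall>n. f n = eval \<alpha> p [n]}" by blast
next
  fix f assume "f \<in> {f. \<exists>p. \<forall>n. f n = eval \<alpha> p [n]}"
  then obtain p where p: "\<And>n. f n = eval \<alpha> p [n]" by blast
  obtain h where "\<And>\<alpha> m n. \<phi> \<alpha> (h m) n = eval \<alpha> (Comp p [Proj 1]) [m, n]"
    using assms unfolding acceptable_numbering_def by meson
  then have "f = \<phi> \<alpha> (h 0)"
    by (intro ext) (simp add: p del: eval.simps(5))
  then show "f \<in> range (\<phi> \<alpha>)" by blast
qed

lemma real_of_bits_surj:
  assumes "x \<in> {0..1}"
  shows "\<exists>\<alpha>. real_of_bits \<alpha> = x"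
proof -
  define y where "y = (\<lambda>n. rec_nat x (\<lambda>_ v. if v \<ge> 1/2 then 2 * v - 1 else 2 * v) n)"
  define \<alpha> where "\<alpha> = (\<lambda>n. y n \<ge> 1/2)"
  have y: "y 0 = x" "y (Suc n) = 2 * y n - of_bool (\<alpha> n)" for n
    by (simp_all add: y_def \<alpha>_def)
  have bd: "0 \<le> y n \<and> y n \<le> 1" for n
    using assms by (induction n) (auto simp: y \<alpha>_def)
  have partial: "(\<Sum>i<n. of_bool (\<alpha> i) / 2 ^ (i + 1)) = x - y n / 2 ^ n" for n
    by (induction n) (simp_all add: y field_simps)
  have "(\<lambda>n. y n / 2 ^ n) \<longlonglongrightarrow> 0"
  proof (rule tendsto_sandwich)
    show "\<forall>\<^sub>F n in sequentially. 0 \<le> y n / 2 ^ n" using bd by simp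
    show "\<forall>\<^sub>F n in sequentially. y n / 2 ^ n \<le> (1/2) ^ n"
      using bd by (simp add: field_simps)
    show "(\<lambda>n. (1/2::real) ^ n) \<longlonglongrightarrow> 0" by (rule LIMSEQ_power_zero) simp
  qed simp
  then have "(\<lambda>n. x - y n / 2 ^ n) \<longlonglongrightarrow> x - 0" by (intro tendsto_intros)
  then have "(\<lambda>i. of_bool (\<alpha> i) / 2 ^ (i + 1)) sums x"
    unfolding sums_def partial by simp
  then show ?thesis unfolding real_of_bits_def using sums_unique by metis
qed

lemma oracles_of_nonempty:
  assumes "computable_pairing pr" "\<forall>n. a n \<in> {0..1}"
  shows "oracles_of pr a \<noteq> {}"
proof -
  obtain \<beta> where \<beta>: "\<And>n. real_of_bits (\<beta> n) = a n"
    using choice[of "\<lambda>n b. real_of_bits b = a n"] real_of_bits_surj assms(2) by blast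
  define \<alpha> where "\<alpha> = (\<lambda>k. case inv (\<lambda>(m, n). pr m n) k of (m, n) \<Rightarrow> \<beta> m n)"
  have "inj (\<lambda>(m, n). pr m n)"
    using assms(1) unfolding computable_pairing_def by (simp add: bij_is_inj)
  from inv_f_f[OF this] have "\<alpha> (pr m n) = \<beta> m n" for m n
    unfolding \<alpha>_def by (metis case_prod_conv)
  then have "seq_of_bits pr \<alpha> = a"
    by (intro ext) (simp add: seq_of_bits_def \<beta>)
  then show ?thesis unfolding oracles_of_def by blast
qed

definition add_prog :: prog where
  "add_prog = PRec (Proj 0) (Comp Succ [Proj 1])"

definition rsub_prog :: prog where
  "rsub_prog = PRec (Proj 0) (Comp (PRec Zero (Proj 0)) [Proj 1])"

definition tri_prog :: prog where
  "tri_prog = PRec Zero (Comp add_prog [Proj 1, Comp Succ [Proj 0]])"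

primrec tri :: "nat \<Rightarrow> nat" where
  "tri 0 = 0"
| "tri (Suc n) = tri n + Suc n"

definition enc_prog :: prog where
  "enc_prog = Comp add_prog [Comp tri_prog [add_prog], Proj 0]"

definition diag_prog :: prog where
  "diag_prog = Mu (Comp rsub_prog [Comp tri_prog [Comp Succ [Proj 0]], Comp Succ [Proj 1]])"

definition fst_prog :: prog where
  "fst_prog = Comp rsub_prog [Comp tri_prog [diag_prog], Proj 0]"

definition snd_prog :: prog where
  "snd_prog = Comp rsub_prog [fst_prog, diag_prog]"

lemma eval_add_prog [simp]: "eval \<alpha> add_prog [m, n] = Some (m + n)"
proof -
  have "rec_nat (Some n) (\<lambda>m r. Option.bind r (\<lambda>v. Some (Suc v))) m = Some (m + n)"
    by (induction m) simp_all
  then show ?thesis by (simp add: add_prog_def)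
qed

lemma eval_pred [simp]: "eval \<alpha> (PRec Zero (Proj 0)) [m] = Some (m - 1)"
proof -
  have "\<exists>y. rec_nat (Some 0) (\<lambda>m r. Option.bind r (\<lambda>v. Some m)) m = Some y" for m :: nat
    by (induction m) auto
  then show ?thesis by (cases m) (auto simp: bind_eq_Some_conv)
qed

lemma eval_rsub_prog [simp]: "eval \<alpha> rsub_prog [m, n] = Some (n - m)"
proof -
  have "rec_nat (Some n) (\<lambda>m r. Option.bind r (\<lambda>v. eval \<alpha> (PRec Zero (Proj 0)) [v])) m
          = Some (n - m)"
    by (induction m) (simp_all del: eval.simps)
  then show ?thesis by (simp add: rsub_prog_def)
qed

lemma eval_tri_prog [simp]: "eval \<alpha> tri_prog [m] = Some (tri m)"
proof -
  have "rec_nat (Some 0) (\<lambda>m r. Option.bind r (\<lambda>v. eval \<alpha> add_prog [v, Suc m])) m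
          = Some (tri m)"
    by (induction m) simp_all
  then show ?thesis by (simp add: tri_prog_def)
qed

lemma eval_enc_prog [simp]: "eval \<alpha> enc_prog [m, n] = Some (tri (m + n) + m)"
  by (simp add: enc_prog_def del: eval.simps(5))

lemma tri_mono: "m \<le> n \<Longrightarrow> tri m \<le> tri n"
  by (induction n) (auto simp: le_Suc_eq)

lemma eval_diag_prog [simp]: "eval \<alpha> diag_prog [tri (m + n) + m] = Some (m + n)"
proof -
  let ?f = "\<lambda>t. Some (Suc (tri (m + n) + m) - tri (Suc t))"
  have "(LEAST t. ?f t = Some 0) = m + n"
  proof (rule Least_equality)
    show "m + n \<le> t" if "?f t = Some 0" for t
    proof (rule ccontr)
      assume "\<not> m + n \<le> t"
      then have "tri (Suc t) \<le> tri (m + n)" by (intro tri_mono) simp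
      with that show False by simp
    qed
  qed simp
  moreover have "\<exists>t. ?f t = Some 0" by (rule exI[of _ "m + n"]) simp
  ultimately have "mu_search ?f = Some (m + n)" by (auto simp: mu_search_def)
  then show ?thesis by (simp add: diag_prog_def del: tri.simps)
qed

lemma eval_fst_prog [simp]: "eval \<alpha> fst_prog [tri (m + n) + m] = Some m"
  by (simp add: fst_prog_def)

lemma eval_snd_prog [simp]: "eval \<alpha> snd_prog [tri (m + n) + m] = Some n"
  by (simp add: snd_prog_def)

lemma oracle_ppca_exists:
  assumes "acceptable_numbering \<phi>" "P \<noteq> {}"
  shows "\<exists>k s. is_ppca \<lparr>par = P, app = \<phi>, comb_k = k, comb_s = s\<rparr>"
proof -
  have smn: "\<exists>h r. \<forall>\<alpha> m n. eval \<alpha> r [m] = Some (h m) \<and> \<phi> \<alpha> (h m) n = eval \<alpha> p [m, n]" for p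
    using assms(1) unfolding acceptable_numbering_def computable1_def by metis
  obtain u where u: "\<And>\<alpha> m n. \<phi> \<alpha> m n = eval \<alpha> u [m, n]"
    using assms(1) unfolding acceptable_numbering_def by blast
  obtain h1 r1 where 1: "\<And>\<alpha> m. eval \<alpha> r1 [m] = Some (h1 m)"
    "\<And>\<alpha> m n. \<phi> \<alpha> (h1 m) n = eval \<alpha> (Proj 0) [m, n]"
    using smn by metis
  obtain hk where k: "\<And>\<alpha> m n. \<phi> \<alpha> (hk m) n = eval \<alpha> (Comp r1 [Proj 1]) [m, n]"
    using smn by metis
  obtain h2 r2 where 2: "\<And>\<alpha> m. eval \<alpha> r2 [m] = Some (h2 m)"
    "\<And>\<alpha> m n. \<phi> \<alpha> (h2 m) n =
       eval \<alpha> (Comp u [Comp u [Comp fst_prog [Proj 0], Proj 1],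
                          Comp u [Comp snd_prog [Proj 0], Proj 1]]) [m, n]"
    using smn by metis
  obtain h3 r3 where 3: "\<And>\<alpha> m. eval \<alpha> r3 [m] = Some (h3 m)"
    "\<And>\<alpha> m n. \<phi> \<alpha> (h3 m) n = eval \<alpha> (Comp r2 [enc_prog]) [m, n]"
    using smn by metis
  obtain hs where s: "\<And>\<alpha> m n. \<phi> \<alpha> (hs m) n = eval \<alpha> (Comp r3 [Proj 1]) [m, n]"
    using smn by metis
  have K: "\<phi> \<alpha> (hk 0) a = Some (h1 a)" "\<phi> \<alpha> (h1 a) b = Some a" for \<alpha> a b
    by (simp_all add: k 1 del: eval.simps(5))
  have S: "\<phi> \<alpha> (hs 0) a = Some (h3 a)" "\<phi> \<alpha> (h3 a) b = Some (h2 (tri (a + b) + a))"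
    "\<phi> \<alpha> (h2 (tri (a + b) + a)) c =
       Option.bind (\<phi> \<alpha> a c) (\<lambda>x. Option.bind (\<phi> \<alpha> b c) (\<phi> \<alpha> x))" for \<alpha> a b c
    by (simp_all add: s 3 2 u[symmetric] del: eval.simps(5))
  have "is_ppca \<lparr>par = P, app = \<phi>, comb_k = hk 0, comb_s = hs 0\<rparr>"
    using assms(2) by (simp add: is_ppca_def oapp_def K S)
  then show ?thesis by blast
qed

end

theory Submission
  imports Defs
begin

text \<open>
  If a program computes approximations of one real in $[0,1]$ under all oracles, then this real is
  \<open>\<mu>\<close> at the index of the program. Hence the Dedekind interval is, internally, the
  quotient of the natural numbers by \<open>\<mu> m = \<mu> n\<close>; and since the \<open>k\<close>-th member of a sequence in the
  interval realized by \<open>n\<close> is \<open>\<mu>\<close> at an index computed from \<open>n\<close> and \<open>k\<close>, the sequences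
  are enumerated by the natural numbers as well. A map on sequences therefore acts on
  codes, and it has a fixed point by Lawvere's diagonal argument: in place of
  \<open>\<nat> \<rightarrow> (I\<^sup>\<nat>)\<^sup>\<nat>\<close> the code \<open>n\<close> is applied to itself before it is evaluated at \<open>k\<close>. The same
  realizers work for maps on \<open>{0, \<dots>, n - 1} \<rightarrow> I\<close>, uniformly in \<open>n\<close>.
\<close>

text \<open>The obstacle is that one number must realize a statement under every oracle in
  \<open>M_\<mu>\<close>, while what it computes may vary with the oracle: a dyadic
  \<open>\<mu> n\<close> inside the interval has two binary expansions, so already the rational
  approximations read off an oracle differ. A map on points therefore does not induce a function on
  codes. It only yields a program whose output, under each oracle, is some code of the right value.
  An s-m-n index, by contrast, is computed without the oracle. Hence an oracle-dependent computation
  is wrapped into a closure, and \<open>\<mu>\<close> is taken at the code of the closure; this lets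
  the diagonal argument work with multivalued data (\<open>mu_slice\<close>,
  \<open>total_into\<close>).

  Truth and realizers are kept apart. Which real a cut denotes, and which sequence a functional
  relation denotes, is settled in the ambient set theory by asking which sets of realizers are
  inhabited; programs then only have to supply the positive data.\<close>

section \<open>Natural deduction for realizers\<close>

text \<open>
  All programs below have one argument, a number coding an environment. In \<open>b \<triangleright> e\<close> the variable
  bound last has value \<open>b\<close>; it is read by \<^const>\<open>fst_prog\<close>, and a program over \<open>e\<close> is weakened
  by \<^const>\<open>snd_prog\<close>.
\<close>

definition push :: "nat \<Rightarrow> nat \<Rightarrow> nat" (infixr "\<triangleright>" 65) where
  "b \<triangleright> e = tri (b + e) + b"

lemma eval_enc_push [simp]: "eval \<alpha> enc_prog [b, e] = Some (b \<triangleright> e)"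
  by (simp add: push_def)

lemma eval_fst_push [simp]: "eval \<alpha> fst_prog [b \<triangleright> e] = Some b"
  by (simp add: push_def)

lemma eval_snd_push [simp]: "eval \<alpha> snd_prog [b \<triangleright> e] = Some e"
  by (simp add: push_def)

declare eval_enc_prog [simp del]

lemma eval_Comp3 [simp]:
  "eval \<alpha> (Comp f [g, h, k]) xs =
     Option.bind (eval \<alpha> g xs) (\<lambda>a. Option.bind (eval \<alpha> h xs) (\<lambda>b.
       Option.bind (eval \<alpha> k xs) (\<lambda>c. eval \<alpha> f [a, b, c])))"
  by (cases "eval \<alpha> g xs"; cases "eval \<alpha> h xs"; cases "eval \<alpha> k xs") auto

declare eval.simps(5) [simp del]

definition pweak :: "prog \<Rightarrow> prog" where
  "pweak t = Comp t [snd_prog]"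

definition plet :: "prog \<Rightarrow> prog \<Rightarrow> prog" where
  "plet t u = Comp u [Comp enc_prog [t, Proj 0]]"

lemma eval_pweak [simp]: "eval \<alpha> (pweak t) [b \<triangleright> e] = eval \<alpha> t [e]"
  by (simp add: pweak_def)

lemma eval_plet [simp]:
  "eval \<alpha> (plet t u) [e] = Option.bind (eval \<alpha> t [e]) (\<lambda>b. eval \<alpha> u [b \<triangleright> e])"
  by (simp add: plet_def)

locale oracle_ppca =
  fixes \<phi> :: "(nat \<Rightarrow> bool) \<Rightarrow> nat \<Rightarrow> nat \<Rightarrow> nat option"
    and T :: "(nat, nat \<Rightarrow> bool) ppca"
  assumes acceptable: "acceptable_numbering \<phi>"
    and ppca: "is_ppca T"
    and app_eq: "app T = \<phi>"
begin

definition univ_prog :: prog where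
  "univ_prog = (SOME u. \<forall>\<alpha> m n. \<phi> \<alpha> m n = eval \<alpha> u [m, n])"

definition papp :: "prog \<Rightarrow> prog \<Rightarrow> prog" where
  "papp t u = Comp univ_prog [t, u]"

text \<open>This is s-m-n with the environment as parameter. The code \<open>h e\<close> does not
  mention \<open>\<alpha>\<close>, although the function with that code does; so codes of closures
  can serve as indices in the sense of Miller sequences.\<close>

definition is_closure :: "prog \<Rightarrow> prog \<Rightarrow> (nat \<Rightarrow> nat) \<Rightarrow> bool" where
  "is_closure t r h \<longleftrightarrow>
     (\<forall>\<alpha> e y. eval \<alpha> r [e] = Some (h e) \<and> \<phi> \<alpha> (h e) y = eval \<alpha> t [y \<triangleright> e])"

definition plam :: "prog \<Rightarrow> prog" where
  "plam t = (SOME r. \<exists>h. is_closure t r h)"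

definition clo :: "prog \<Rightarrow> nat \<Rightarrow> nat" where
  "clo t = (SOME h. is_closure t (plam t) h)"

lemma eval_univ_prog [simp]: "eval \<alpha> univ_prog [m, n] = \<phi> \<alpha> m n"
proof -
  have "\<exists>u. \<forall>\<alpha> m n. \<phi> \<alpha> m n = eval \<alpha> u [m, n]"
    using acceptable unfolding acceptable_numbering_def by blast
  from someI_ex[OF this] show ?thesis unfolding univ_prog_def by metis
qed

lemma eval_papp [simp]:
  "eval \<alpha> (papp t u) xs =
     Option.bind (eval \<alpha> t xs) (\<lambda>a. Option.bind (eval \<alpha> u xs) (\<phi> \<alpha> a))"
  by (simp add: papp_def)

lemma is_closure_clo: "is_closure t (plam t) (clo t)"
proof -
  obtain h where h: "computable1 h"
    "\<And>\<alpha> m n. \<phi> \<alpha> (h m) n = eval \<alpha> (Comp t [Comp enc_prog [Proj 1, Proj 0]]) [m, n]"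
    using acceptable unfolding acceptable_numbering_def by meson
  then obtain r where "\<And>\<alpha> x. eval \<alpha> r [x] = Some (h x)"
    unfolding computable1_def by blast
  then have "is_closure t r h"
    using h(2) by (simp add: is_closure_def)
  then have "\<exists>r h. is_closure t r h" by blast
  from someI_ex[OF this] have "\<exists>h. is_closure t (plam t) h"
    unfolding plam_def .
  from someI_ex[OF this] show ?thesis unfolding clo_def .
qed

lemma eval_plam [simp]: "eval \<alpha> (plam t) [e] = Some (clo t e)"
  using is_closure_clo unfolding is_closure_def by blast

lemma app_clo [simp]: "\<phi> \<alpha> (clo t e) y = eval \<alpha> t [y \<triangleright> e]"
  using is_closure_clo unfolding is_closure_def by blast

lemma par_nonempty: "par T \<noteq> {}"
  using ppca unfolding is_ppca_def by blast

lemma app_true: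
  assumes "p \<in> par T"
  obtains c where "\<phi> p (comb_true T) a = Some c" "\<phi> p c b = Some a"
proof -
  have "oapp T p (app T p (comb_k T) a) (Some b) = Some a"
    using ppca assms unfolding is_ppca_def by blast
  then show ?thesis
    using that by (auto simp: oapp_def bind_eq_Some_conv app_eq comb_true_def)
qed

lemma app0_eq:
  assumes "p \<in> par T" "app T p a b = Some c" "\<And>p'. p' \<in> par T \<Longrightarrow> app T p' a b = app T p a b"
  shows "app0 T a b = c"
proof -
  have "(SOME p. p \<in> par T) \<in> par T" using assms(1) by (metis someI)
  from assms(3)[OF this] show ?thesis using assms(2) by (simp add: app0_def)
qed

text \<open>\<open>comb_false\<close> is \<open>K (S K K)\<close>: it drops \<open>a\<close> and
  leaves the identity. As \<open>app0\<close> evaluates at one chosen parameter, each of its three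
  applications must first be seen to be independent of the parameter.\<close>

lemma app_false:
  assumes p: "p \<in> par T"
  obtains c where "\<phi> p (comb_false T) a = Some c" "\<phi> p c b = Some b"
proof -
  let ?k = "comb_k T" and ?s = "comb_s T"
  have ax: "app T p ?k a = app T p' ?k a"
    "oapp T p (app T p ?k a) (Some b) = Some a"
    "app T p ?s a = app T p' ?s a"
    "oapp T p (app T p ?s a) (Some b) = oapp T p' (app T p' ?s a) (Some b)"
    "oapp T p (app T p ?s a) (Some b) \<noteq> None"
    "oapp T p (oapp T p (app T p ?s a) (Some b)) (Some c) =
       oapp T p (app T p a c) (app T p b c)" if "p \<in> par T" "p' \<in> par T" for p p' a b c
    using ppca that unfolding is_ppca_def by blast+
  obtain y where y: "oapp T p (app T p ?s ?k) (Some ?k) = Some y"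
    using ax(5)[OF p p] by blast
  then obtain x where x: "app T p ?s ?k = Some x" "app T p x ?k = Some y"
    by (auto simp: oapp_def bind_eq_Some_conv)
  have x': "app T p' x ?k = app T p x ?k" if "p' \<in> par T" for p'
    using ax(4)[OF p that, of ?k ?k] ax(3)[OF p that, of ?k, symmetric] x(1) by (simp add: oapp_def)
  have sk: "app0 T ?s ?k = x"
    by (rule app0_eq[OF p x(1)]) (rule ax(3)[OF _ p])
  have skk: "app0 T x ?k = y"
    by (rule app0_eq[OF p x(2) x'])
  obtain f where f: "app T p ?k y = Some f" "app T p f a = Some y"
    using ax(2)[OF p p, of y a] by (auto simp: oapp_def bind_eq_Some_conv)
  have ff: "comb_false T = f"
    unfolding comb_false_def sk skk by (rule app0_eq[OF p f(1)]) (rule ax(1)[OF _ p])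
  obtain d where d: "app T p ?k b = Some d"
    using ax(2)[OF p p, of b b] by (auto simp: oapp_def bind_eq_Some_conv)
  \<comment> \<open>\<open>S K K b\<close> is \<open>(K b) (K b)\<close>, so \<open>d = K b\<close>
    is applied to itself.\<close>
  then have "app T p d d = Some b"
    using ax(2)[OF p p, of b d] by (simp add: oapp_def)
  with d have "app T p y b = Some b"
    using ax(6)[OF p p, of ?k ?k b, unfolded y] by (simp add: oapp_def)
  with f ff show ?thesis using that by (simp add: app_eq)
qed

lemma true_neq_false: "comb_true T \<noteq> comb_false T"
proof
  assume eq: "comb_true T = comb_false T"
  obtain p where p: "p \<in> par T" using par_nonempty by blast
  obtain c where "\<phi> p (comb_true T) 0 = Some c" "\<phi> p c 1 = Some 0"
    using app_true[OF p] by metis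
  moreover obtain c where "\<phi> p (comb_false T) 0 = Some c" "\<phi> p c 1 = Some 1"
    using app_false[OF p] by metis
  ultimately show False using eq by simp
qed

text \<open>The environment is the same for all oracles, but the value of \<open>t\<close> need not
  be; only its membership in \<open>S\<close> is common to all parameters.\<close>

definition rz :: "prog \<Rightarrow> nat \<Rightarrow> nat set \<Rightarrow> bool" where
  "rz t e S \<longleftrightarrow> (\<forall>p\<in>par T. \<exists>c. eval p t [e] = Some c \<and> c \<in> S)"

definition pfst :: "prog \<Rightarrow> prog" where
  "pfst t = papp t (const_prog (comb_true T))"

definition psnd :: "prog \<Rightarrow> prog" where
  "psnd t = papp t (const_prog (comb_false T))"

text \<open>A Church pair as a closure over the environment: its code is the same under every
  oracle, and a component is recomputed at the parameter at which it is projected.\<close>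

definition ppair :: "prog \<Rightarrow> prog \<Rightarrow> prog" where
  "ppair t u = plam (papp (papp fst_prog (pweak t)) (pweak u))"

text \<open>A realizer of \<open>rall\<close> takes a dummy argument, which is ignored here and set
  to 0 in \<open>pspec\<close>.\<close>

definition pgen :: "prog \<Rightarrow> prog" where
  "pgen t = plam (pweak t)"

definition pspec :: "prog \<Rightarrow> prog" where
  "pspec t = papp t (const_prog 0)"

lemma rz_nonempty: "rz t e S \<Longrightarrow> S \<noteq> {}"
  using par_nonempty unfolding rz_def by blast

lemma rz_mono: "rz t e S \<Longrightarrow> S \<subseteq> S' \<Longrightarrow> rz t e S'"
  unfolding rz_def by blast

lemma rz_here: "b \<in> S \<Longrightarrow> rz fst_prog (b \<triangleright> e) S"
  by (simp add: rz_def)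

lemma rz_weak: "rz t e S \<Longrightarrow> rz (pweak t) (b \<triangleright> e) S"
  by (simp add: rz_def)

lemma rz_const: "b \<in> S \<Longrightarrow> rz (const_prog b) e S"
  by (simp add: rz_def)

lemma rz_let:
  assumes "rz t e S" "\<And>b. b \<in> S \<Longrightarrow> rz u (b \<triangleright> e) S'"
  shows "rz (plet t u) e S'"
  using assms unfolding rz_def by fastforce

lemma rz_impI:
  assumes "\<And>b. b \<in> U \<Longrightarrow> rz t (b \<triangleright> e) V"
  shows "rz (plam t) e (rimp T U V)"
  using assms by (auto simp: rz_def rimp_def app_in_def app_eq)

lemma rz_impE:
  assumes "rz t e (rimp T U V)" "rz u e U"
  shows "rz (papp t u) e V"
  using assms unfolding rz_def rimp_def app_in_def app_eq by fastforce

lemma rz_allI: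
  assumes "\<And>y. rz t e (\<psi> y)"
  shows "rz (pgen t) e (rall T \<psi>)"
  using assms by (auto simp: rz_def rall_def all_along_def app_in_def app_eq pgen_def)

lemma rz_allE:
  assumes "rz t e (rall T \<psi>)"
  shows "rz (pspec t) e (\<psi> y)"
  using assms unfolding rz_def rall_def all_along_def app_in_def app_eq pspec_def by fastforce

lemma app_ppair:
  assumes p: "p \<in> par T" and t: "eval p t [e] = Some a" and u: "eval p u [e] = Some b"
  shows "\<exists>c. (\<forall>\<alpha>. eval \<alpha> (ppair t u) [e] = Some c)"
    "eval \<alpha> (ppair t u) [e] = Some c \<Longrightarrow> \<phi> p c (comb_true T) = Some a"
    "eval \<alpha> (ppair t u) [e] = Some c \<Longrightarrow> \<phi> p c (comb_false T) = Some b"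
proof -
  show "\<exists>c. (\<forall>\<alpha>. eval \<alpha> (ppair t u) [e] = Some c)"
    by (simp add: ppair_def)
  obtain d where "\<phi> p (comb_true T) a = Some d" "\<phi> p d b = Some a"
    using app_true[OF p] .
  then show "eval \<alpha> (ppair t u) [e] = Some c \<Longrightarrow> \<phi> p c (comb_true T) = Some a"
    using t u by (auto simp: ppair_def)
  obtain d where "\<phi> p (comb_false T) a = Some d" "\<phi> p d b = Some b"
    using app_false[OF p] .
  then show "eval \<alpha> (ppair t u) [e] = Some c \<Longrightarrow> \<phi> p c (comb_false T) = Some b"
    using t u by (auto simp: ppair_def)
qed

lemma rz_pair:
  assumes t: "rz t e U" and u: "rz u e V"
  shows "rz (ppair t u) e (rand T U V)"
  unfolding rz_def
proof
  fix \<alpha> assume "\<alpha> \<in> par T"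
  then obtain c where c: "\<And>\<beta>. eval \<beta> (ppair t u) [e] = Some c"
    using app_ppair(1) t u unfolding rz_def by blast
  have "c \<in> rand T U V"
    unfolding rand_def app_in_def app_eq
    using t u app_ppair(2,3)[OF _ _ _ c] unfolding rz_def by fastforce
  with c show "\<exists>c. eval \<alpha> (ppair t u) [e] = Some c \<and> c \<in> rand T U V" by blast
qed

text \<open>Tag and payload have to match only for each parameter separately. In \<open>ror\<close>
  the quantifier over parameters stands outside the disjunction, so different oracles may choose
  different disjuncts.\<close>

lemma rz_orI:
  assumes "\<And>p. p \<in> par T \<Longrightarrow> \<exists>a b. eval p t [e] = Some a \<and> eval p u [e] = Some b \<and>
      (a = comb_true T \<and> b \<in> U \<or> a = comb_false T \<and> b \<in> V)"
  shows "rz (ppair t u) e (ror T U V)"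
  unfolding rz_def
proof
  fix \<alpha> assume "\<alpha> \<in> par T"
  then obtain c where c: "\<And>\<beta>. eval \<beta> (ppair t u) [e] = Some c"
    using app_ppair(1) assms by meson
  have "c \<in> ror T U V"
    unfolding ror_def app_in_def app_eq mem_Collect_eq
  proof
    fix p assume p: "p \<in> par T"
    from assms[OF p] obtain a b where ab: "eval p t [e] = Some a" "eval p u [e] = Some b"
      "a = comb_true T \<and> b \<in> U \<or> a = comb_false T \<and> b \<in> V" by blast
    show "(\<exists>d. \<phi> p c (comb_true T) = Some d \<and> d \<in> {comb_true T}) \<and>
        (\<exists>d. \<phi> p c (comb_false T) = Some d \<and> d \<in> U) \<or>
        (\<exists>d. \<phi> p c (comb_true T) = Some d \<and> d \<in> {comb_false T}) \<and>
        (\<exists>d. \<phi> p c (comb_false T) = Some d \<and> d \<in> V)"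
      using app_ppair(2,3)[OF p ab(1,2) c] ab(3) by auto
  qed
  with c show "\<exists>c. eval \<alpha> (ppair t u) [e] = Some c \<and> c \<in> ror T U V" by blast
qed

lemma rz_fst:
  assumes "rz t e (rand T U V)"
  shows "rz (pfst t) e U"
  using assms unfolding rz_def rand_def app_in_def app_eq pfst_def by fastforce

lemma rz_snd:
  assumes "rz t e (rand T U V)"
  shows "rz (psnd t) e V"
  using assms unfolding rz_def rand_def app_in_def app_eq psnd_def by fastforce

text \<open>With one side uninhabited, the tag is forced under every oracle, and the payload can be
  used without inspecting it.\<close>

lemma rz_or_left:
  assumes "rz t e (ror T U V)" "V = {}"
  shows "rz (psnd t) e U"
  using assms unfolding rz_def ror_def app_in_def app_eq psnd_def by fastforce

lemma rz_or_right:
  assumes "rz t e (ror T U V)" "U = {}"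
  shows "rz (psnd t) e V"
  using assms unfolding rz_def ror_def app_in_def app_eq psnd_def by fastforce

lemma rz_lift: "b \<Longrightarrow> rz (const_prog 0) e (lift b)"
  by (simp add: rz_def lift_def rtop_def)

lemma rex_eq: "rex \<psi> = (\<Union>y. \<psi> y)"
  by (simp add: rex_def ex_along_def)

lemma rz_exE:
  assumes "rz t e (rex \<psi>)" "\<And>y b. b \<in> \<psi> y \<Longrightarrow> rz u (b \<triangleright> e) S"
  shows "rz (plet t u) e S"
  using assms by (intro rz_let[of t e "rex \<psi>" u]) (auto simp: rex_eq)

lemma rz_all_inI:
  assumes "\<And>x b. b \<in> X x x \<Longrightarrow> rz t (b \<triangleright> e) (\<psi> x)"
  shows "rz (pgen (plam t)) e (all_in T X \<psi>)"
  unfolding all_in_def by (intro rz_allI rz_impI assms)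

lemma rz_all_inE:
  assumes "rz t e (all_in T X \<psi>)" "rz u e (X x x)"
  shows "rz (papp (pspec t) u) e (\<psi> x)"
  using rz_impE[OF rz_allE[OF assms(1)[unfolded all_in_def], of x] assms(2)] .

lemma rz_ex_inI:
  assumes "rz t e (X x x)" "rz u e (\<psi> x)"
  shows "rz (ppair t u) e (ex_in T X \<psi>)"
  by (rule rz_mono[OF rz_pair[where U = "X x x" and V = "\<psi> x"]]) (use assms in \<open>auto simp: ex_in_def rex_eq\<close>)

lemma rz_ex_inE:
  assumes "rz t e (ex_in T X \<psi>)"
    and "\<And>x b. b \<in> rand T (X x x) (\<psi> x) \<Longrightarrow> rz u (b \<triangleright> e) S"
  shows "rz (plet t u) e S"
  using assms unfolding ex_in_def by (rule rz_exE)

lemma holds_if_rz: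
  assumes "rz t 0 S"
  shows "holds T S"
  using assms unfolding holds_def tle_def
  by (intro exI[of _ "clo (pweak t) 0"]) (auto simp: rz_def app_in_def app_eq)

end

section \<open>Rational bounds from binary digits\<close>

definition mult_prog :: prog where
  "mult_prog = PRec Zero (Comp add_prog [Proj 1, Proj 2])"

definition pow2_prog :: prog where
  "pow2_prog = PRec (const_prog 1) (Comp add_prog [Proj 1, Proj 1])"

definition less_prog :: prog where
  "less_prog = Comp (PRec Zero (const_prog 1)) [rsub_prog]"

definition diff_prog :: prog where
  "diff_prog = Comp add_prog [rsub_prog, Comp rsub_prog [Proj 1, Proj 0]]"

text \<open>The recursion step discards its previous value: in \<open>[m, v, a, b]\<close> the entry
  \<open>Proj 3\<close> is \<open>b\<close>. Both alternatives are evaluated before the choice, so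
  both must be defined.\<close>

definition cond_prog :: prog where
  "cond_prog = PRec (Proj 0) (Proj 3)"

lemma eval_mult_prog [simp]: "eval \<alpha> mult_prog [m, n] = Some (m * n)"
proof -
  have "rec_nat (Some 0) (\<lambda>m r. Option.bind r (\<lambda>v. eval \<alpha> (Comp add_prog [Proj 1, Proj 2]) [m, v, n])) m
          = Some (m * n)"
    by (induction m) simp_all
  then show ?thesis by (simp add: mult_prog_def)
qed

lemma eval_pow2_prog [simp]: "eval \<alpha> pow2_prog [m] = Some (2 ^ m)"
proof -
  have "rec_nat (Some 1) (\<lambda>m r. Option.bind r (\<lambda>v. eval \<alpha> (Comp add_prog [Proj 1, Proj 1]) [m, v])) m
          = Some (2 ^ m)"
    by (induction m) simp_all
  then show ?thesis by (simp add: pow2_prog_def)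
qed

lemma eval_less_prog [simp]: "eval \<alpha> less_prog [m, n] = Some (of_bool (m < n))"
proof -
  have "rec_nat (Some 0) (\<lambda>m r. Option.bind r (\<lambda>v. Some (Suc 0))) k = Some (of_bool (0 < k))" for k :: nat
    by (induction k) simp_all
  then show ?thesis by (simp add: less_prog_def)
qed

lemma eval_diff_prog [simp]: "eval \<alpha> diff_prog [m, n] = Some ((n - m) + (m - n))"
  by (simp add: diff_prog_def)

lemma eval_cond_prog [simp]: "eval \<alpha> cond_prog [c, a, b] = Some (if c = 0 then a else b)"
  by (cases c) (auto simp: cond_prog_def intro: nat.induct)

definition psearch :: "prog \<Rightarrow> prog" where
  "psearch t = Mu (Comp t [enc_prog])"

lemma eval_Mu_total:
  assumes "\<And>n. eval \<alpha> f (n # xs) = Some (F n)" and "F n = 0"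
  shows "\<exists>n. eval \<alpha> (Mu f) xs = Some n \<and> F n = 0 \<and> (\<forall>m<n. F m \<noteq> 0)"
proof -
  let ?n = "LEAST n. F n = 0"
  have "F ?n = 0" using assms(2) by (rule LeastI)
  moreover have "eval \<alpha> (Mu f) xs = Some ?n"
    using assms by (auto simp: mu_search_def)
  ultimately show ?thesis using not_less_Least by blast
qed

lemma eval_psearch_total:
  assumes "\<And>n. eval \<alpha> t [n \<triangleright> e] = Some (F n)" and "F n = 0"
  shows "\<exists>n. eval \<alpha> (psearch t) [e] = Some n \<and> F n = 0 \<and> (\<forall>m<n. F m \<noteq> 0)"
  unfolding psearch_def using assms by (intro eval_Mu_total) auto

text \<open>Cross-multiplication, with the subtracted terms moved to the other side, reduces the
  comparison to natural numbers.\<close>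

lemma rat_less_prog_exists:
  assumes "computable_rat_enumeration q"
  shows "\<exists>p. \<forall>\<alpha> m n. eval \<alpha> p [m, n] = Some (of_bool (q m < q n))"
proof -
  obtain a b c A B C where
    A: "\<And>\<alpha> n. eval \<alpha> A [n] = Some (a n)" and B: "\<And>\<alpha> n. eval \<alpha> B [n] = Some (b n)" and
    C: "\<And>\<alpha> n. eval \<alpha> C [n] = Some (c n)" and
    q: "\<And>n. q n = (of_nat (a n) - of_nat (b n)) / of_nat (Suc (c n))"
    using assms unfolding computable_rat_enumeration_def computable1_def by blast
  let ?side = "\<lambda>i j. Comp add_prog [Comp mult_prog [Comp A [Proj i], Comp Succ [Comp C [Proj j]]],
                                     Comp mult_prog [Comp B [Proj j], Comp Succ [Comp C [Proj i]]]]"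
  have less: "(q m < q n) = (a m * Suc (c n) + b n * Suc (c m) < a n * Suc (c m) + b m * Suc (c n))" for m n
  proof -
    have "(q m < q n) \<longleftrightarrow> (of_nat (a m) - of_nat (b m)) * of_nat (Suc (c n))
              < (of_nat (a n) - of_nat (b n)) * (of_nat (Suc (c m)) :: rat)"
      unfolding q by (simp add: field_simps del: of_nat_Suc)
    also have "\<dots> \<longleftrightarrow> of_nat (a m * Suc (c n) + b n * Suc (c m))
              < (of_nat (a n * Suc (c m) + b m * Suc (c n)) :: rat)"
      unfolding of_nat_add of_nat_mult by (simp add: algebra_simps del: of_nat_Suc)
    finally show ?thesis by (simp only: of_nat_less_iff)
  qed
  show ?thesis
    by (rule exI[of _ "Comp less_prog [?side 0 1, ?side 1 0]"]) (simp add: A B C less)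
qed

text \<open>As the enumeration is surjective, an index of the fraction is found by unbounded search;
  the sum of the two truncated differences vanishes exactly at equality.\<close>

lemma rat_frac_prog_exists:
  assumes "computable_rat_enumeration q"
  shows "\<exists>p. \<forall>\<alpha> i k N. 0 < N \<longrightarrow>
    (\<exists>g. eval \<alpha> p [i, k, N] = Some g \<and> q g = (of_nat i - of_nat k) / of_nat N)"
proof -
  obtain a b c A B C where bij: "bij q" and
    A: "\<And>\<alpha> n. eval \<alpha> A [n] = Some (a n)" and B: "\<And>\<alpha> n. eval \<alpha> B [n] = Some (b n)" and
    C: "\<And>\<alpha> n. eval \<alpha> C [n] = Some (c n)" and
    q: "\<And>n. q n = (of_nat (a n) - of_nat (b n)) / of_nat (Suc (c n))"
    using assms unfolding computable_rat_enumeration_def computable1_def by blast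
  let ?test = "Comp diff_prog
    [Comp add_prog [Comp mult_prog [Comp A [Proj 0], Proj 3], Comp mult_prog [Proj 2, Comp Succ [Comp C [Proj 0]]]],
     Comp add_prog [Comp mult_prog [Comp B [Proj 0], Proj 3], Comp mult_prog [Proj 1, Comp Succ [Comp C [Proj 0]]]]]"
  let ?F = "\<lambda>N i k g. (b g * N + i * Suc (c g)) - (a g * N + k * Suc (c g))
              + ((a g * N + k * Suc (c g)) - (b g * N + i * Suc (c g)))"
  have zero: "?F N i k g = 0 \<longleftrightarrow> q g = (of_nat i - of_nat k) / of_nat N" if N: "0 < N" for N i k g
  proof -
    have "?F N i k g = 0 \<longleftrightarrow> a g * N + k * Suc (c g) = b g * N + i * Suc (c g)"
      by linarith
    also have "\<dots> \<longleftrightarrow> (of_nat (a g * N + k * Suc (c g)) :: rat) = of_nat (b g * N + i * Suc (c g))"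
      by (simp only: of_nat_eq_iff)
    also have "\<dots> \<longleftrightarrow> (of_nat (a g) - of_nat (b g)) * (of_nat N :: rat) = (of_nat i - of_nat k) * of_nat (Suc (c g))"
      unfolding of_nat_add of_nat_mult by (simp add: algebra_simps del: of_nat_Suc)
    also have "\<dots> \<longleftrightarrow> q g = (of_nat i - of_nat k) / of_nat N"
      unfolding q using N by (simp add: frac_eq_eq del: of_nat_Suc)
    finally show ?thesis .
  qed
  have "\<exists>g. eval \<alpha> (Mu ?test) [i, k, N] = Some g \<and> q g = (of_nat i - of_nat k) / of_nat N"
    if N: "0 < N" for \<alpha> i k N
  proof -
    obtain g where "q g = (of_nat i - of_nat k) / of_nat N"
      using bij by (metis bij_pointE)
    then have F: "?F N i k g = 0" using zero[OF N] by blast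
    have "eval \<alpha> ?test (g # [i, k, N]) = Some (?F N i k g)" for g
      by (simp add: A B C)
    from eval_Mu_total[OF this F] obtain h where
      "eval \<alpha> (Mu ?test) [i, k, N] = Some h" "?F N i k h = 0"
      by (elim exE conjE)
    then show ?thesis unfolding zero[OF N] by (intro exI conjI)
  qed
  then show ?thesis by blast
qed

lemma real_of_bits_bounds:
  fixes \<alpha> :: "nat \<Rightarrow> bool"
  defines "S \<equiv> \<lambda>j. \<Sum>i<j. of_bool (\<alpha> i) / 2 ^ (i + 1) :: real"
  shows "S j \<le> real_of_bits \<alpha>" "real_of_bits \<alpha> \<le> S j + 1 / 2 ^ j"
proof -
  let ?f = "\<lambda>i. of_bool (\<alpha> i) / 2 ^ (i + 1) :: real"
  have geo: "(\<lambda>i. 1 / 2 ^ (i + j + 1) :: real) sums (1 / 2 ^ j)"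
  proof -
    have "(\<lambda>i. (1 / 2 ^ (j + 1)) * (1 / 2) ^ i :: real) sums ((1 / 2 ^ (j + 1)) * (1 / (1 - 1 / 2)))"
      by (intro sums_mult geometric_sums) simp
    then show ?thesis by (simp add: power_add power_divide field_simps)
  qed
  have le: "?f (i + j) \<le> 1 / 2 ^ (i + j + 1)" for i
    by (simp add: field_simps)
  have sum: "summable (\<lambda>i. ?f (i + j))"
    using geo le by (intro summable_comparison_test'[OF sums_summable[OF geo]]) simp
  then have split: "real_of_bits \<alpha> = (\<Sum>i. ?f (i + j)) + S j"
    unfolding real_of_bits_def S_def
    using suminf_split_initial_segment[of ?f j] summable_iff_shift[of ?f j] by simp
  show "S j \<le> real_of_bits \<alpha>"
    unfolding split using suminf_nonneg[OF sum] by simp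
  show "real_of_bits \<alpha> \<le> S j + 1 / 2 ^ j"
    unfolding split using suminf_le[OF le sum sums_summable[OF geo]] sums_unique[OF geo] by simp
qed

text \<open>The first \<open>j\<close> digits form an integer \<open>D\<close> with
  \<open>D / 2^j \<le> a n \<le> (D + 1) / 2^j\<close>. The numerators \<open>D - 1\<close> and
  \<open>D + 2\<close> make the bounds strict, and each bound is off by at most
  \<open>2 / 2^j\<close>. If \<open>a n\<close> has two expansions, \<open>D\<close> and the bounds
  depend on the oracle.\<close>

lemma bounds_prog_exists:
  assumes "computable_pairing pr" and q: "computable_rat_enumeration q"
  shows "\<exists>lo hi. \<forall>a \<alpha> n j. \<alpha> \<in> oracles_of pr a \<longrightarrow>
    (\<exists>l. eval \<alpha> lo [n, j] = Some l \<and> of_rat (q l) < a n \<and> a n - of_rat (q l) \<le> 2 / 2 ^ j) \<and>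
    (\<exists>u. eval \<alpha> hi [n, j] = Some u \<and> a n < of_rat (q u) \<and> of_rat (q u) - a n \<le> 2 / 2 ^ j)"
proof -
  obtain P where P: "\<And>\<alpha> m n. eval \<alpha> P [m, n] = Some (pr m n)"
    using assms(1) unfolding computable_pairing_def computable2_def by blast
  obtain frac where frac: "\<And>\<alpha> i k N. 0 < N \<Longrightarrow>
      \<exists>g. eval \<alpha> frac [i, k, N] = Some g \<and> q g = (of_nat i - of_nat k) / of_nat N"
    using rat_frac_prog_exists[OF q] by blast
  define step where "step = Comp add_prog
    [Comp add_prog [Proj 1, Proj 1], Comp Orc [Comp P [Proj 2, Proj 0]]]"
  define D where "D = (\<lambda>\<alpha> n. rec_nat 0 (\<lambda>i v. v + v + of_bool (\<alpha> (pr n i))) :: nat \<Rightarrow> nat)"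
  have dig: "eval \<alpha> (PRec Zero step) [j, n] = Some (D \<alpha> n j)" for \<alpha> n j
    by (induction j) (simp_all add: D_def step_def P)
  have DS: "real (D \<alpha> n j) / 2 ^ j = (\<Sum>i<j. of_bool (\<alpha> (pr n i)) / 2 ^ (i + 1))" for \<alpha> n j
    by (induction j) (simp_all add: D_def field_simps)
  define lo where "lo = Comp frac [Comp (PRec Zero step) [Proj 1, Proj 0], const_prog 1, Comp pow2_prog [Proj 1]]"
  define hi where "hi = Comp frac [Comp Succ [Comp Succ [Comp (PRec Zero step) [Proj 1, Proj 0]]], Zero, Comp pow2_prog [Proj 1]]"
  have "\<exists>l. eval \<alpha> lo [n, j] = Some l \<and> of_rat (q l) < a n \<and> a n - of_rat (q l) \<le> 2 / 2 ^ j"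
    "\<exists>u. eval \<alpha> hi [n, j] = Some u \<and> a n < of_rat (q u) \<and> of_rat (q u) - a n \<le> 2 / 2 ^ j"
    if \<alpha>: "\<alpha> \<in> oracles_of pr a" for a :: "nat \<Rightarrow> real" and \<alpha> n j
  proof -
    have "a n = real_of_bits (\<lambda>m. \<alpha> (pr n m))"
      using \<alpha> by (auto simp: oracles_of_def seq_of_bits_def)
    then have bd: "real (D \<alpha> n j) / 2 ^ j \<le> a n" "a n \<le> real (D \<alpha> n j) / 2 ^ j + 1 / 2 ^ j"
      using real_of_bits_bounds[of "\<lambda>m. \<alpha> (pr n m)" j] by (simp_all add: DS)
    have pos: "(0::real) < 1 / 2 ^ j" and two: "(2::real) / 2 ^ j = 1 / 2 ^ j + 1 / 2 ^ j" by simp_all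
    obtain l where l: "eval \<alpha> lo [n, j] = Some l" "q l = (of_nat (D \<alpha> n j) - of_nat 1) / of_nat (2 ^ j)"
      using frac[of "2 ^ j" \<alpha> "D \<alpha> n j" 1] by (auto simp: lo_def dig simp del: eval.simps(6))
    have "of_rat (q l) = real (D \<alpha> n j) / 2 ^ j - 1 / 2 ^ j"
      unfolding l by (simp add: of_rat_divide of_rat_diff of_rat_power diff_divide_distrib)
    with l(1) bd pos show "\<exists>l. eval \<alpha> lo [n, j] = Some l \<and> of_rat (q l) < a n \<and> a n - of_rat (q l) \<le> 2 / 2 ^ j"
      unfolding two by (intro exI[of _ l] conjI) linarith+
    obtain u where u: "eval \<alpha> hi [n, j] = Some u" "q u = (of_nat (Suc (Suc (D \<alpha> n j))) - of_nat 0) / of_nat (2 ^ j)"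
      using frac[of "2 ^ j" \<alpha> "Suc (Suc (D \<alpha> n j))" 0] by (auto simp: hi_def dig simp del: eval.simps(6))
    have "of_rat (q u) = real (D \<alpha> n j) / 2 ^ j + 2 / 2 ^ j"
      unfolding u by (simp add: of_rat_divide of_rat_add of_rat_power add_divide_distrib)
    with u(1) bd pos show "\<exists>u. eval \<alpha> hi [n, j] = Some u \<and> a n < of_rat (q u) \<and> of_rat (q u) - a n \<le> 2 / 2 ^ j"
      unfolding two by (intro exI[of _ u] conjI) linarith+
  qed
  then show ?thesis by blast
qed

section \<open>Indices for a Miller sequence\<close>

locale miller = oracle_ppca +
  fixes pr :: "nat \<Rightarrow> nat \<Rightarrow> nat" and q :: "nat \<Rightarrow> rat" and \<mu> :: "nat \<Rightarrow> real"
  assumes pairing: "computable_pairing pr"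
    and enum: "computable_rat_enumeration q"
    and miller: "miller_sequence \<phi> pr q \<mu>"
    and par_eq: "par T = oracles_of pr \<mu>"
begin

definition lt_prog :: prog where
  "lt_prog = (SOME p. \<forall>\<alpha> m n. eval \<alpha> p [m, n] = Some (of_bool (q m < q n)))"

definition frac_prog :: prog where
  "frac_prog = (SOME p. \<forall>\<alpha> i k N. 0 < N \<longrightarrow>
    (\<exists>g. eval \<alpha> p [i, k, N] = Some g \<and> q g = (of_nat i - of_nat k) / of_nat N))"

definition bounds_prog :: "prog \<Rightarrow> prog \<Rightarrow> bool" where
  "bounds_prog lo hi \<longleftrightarrow> (\<forall>\<alpha>\<in>par T. \<forall>n j.
    (\<exists>l. eval \<alpha> lo [n, j] = Some l \<and> of_rat (q l) < \<mu> n \<and> \<mu> n - of_rat (q l) \<le> 2 / 2 ^ j) \<and>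
    (\<exists>u. eval \<alpha> hi [n, j] = Some u \<and> \<mu> n < of_rat (q u) \<and> of_rat (q u) - \<mu> n \<le> 2 / 2 ^ j))"

definition lo_prog :: prog where
  "lo_prog = (SOME lo. \<exists>hi. bounds_prog lo hi)"

definition hi_prog :: prog where
  "hi_prog = (SOME hi. bounds_prog lo_prog hi)"

lemma eval_lt_prog [simp]: "eval \<alpha> lt_prog [m, n] = Some (of_bool (q m < q n))"
  using someI_ex[OF rat_less_prog_exists[OF enum]] unfolding lt_prog_def by blast

lemma eval_frac_prog:
  "0 < N \<Longrightarrow> \<exists>g. eval \<alpha> frac_prog [i, k, N] = Some g \<and> q g = (of_nat i - of_nat k) / of_nat N"
  using someI_ex[OF rat_frac_prog_exists[OF enum]] unfolding frac_prog_def by blast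

lemma bounds: "bounds_prog lo_prog hi_prog"
proof -
  have "\<exists>lo hi. bounds_prog lo hi"
    unfolding bounds_prog_def par_eq using bounds_prog_exists[OF pairing enum] by meson
  from someI_ex[OF this] have "\<exists>hi. bounds_prog lo_prog hi" unfolding lo_prog_def .
  from someI_ex[OF this] show ?thesis unfolding hi_prog_def .
qed

lemma eval_lo_prog:
  assumes "\<alpha> \<in> par T"
  obtains l where "eval \<alpha> lo_prog [n, j] = Some l" "of_rat (q l) < \<mu> n" "\<mu> n - of_rat (q l) \<le> 2 / 2 ^ j"
  using bounds assms unfolding bounds_prog_def by blast

lemma eval_hi_prog:
  assumes "\<alpha> \<in> par T"
  obtains u where "eval \<alpha> hi_prog [n, j] = Some u" "\<mu> n < of_rat (q u)" "of_rat (q u) - \<mu> n \<le> 2 / 2 ^ j"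
  using bounds assms unfolding bounds_prog_def by blast

lemma q_surj: "\<exists>k. q k = r"
  using enum unfolding computable_rat_enumeration_def by (metis bij_pointE)

lemma mu_bounds: "0 \<le> \<mu> n" "\<mu> n \<le> 1"
  using miller unfolding miller_sequence_def by auto

lemma represents_unique:
  assumes "represents q g x" "represents q g y"
  shows "x = y"
proof (rule ccontr)
  assume "x \<noteq> y"
  then obtain n where "(1 / 2) ^ n < \<bar>x - y\<bar> / 2"
    using real_arch_pow_inv[of "\<bar>x - y\<bar> / 2" "1 / 2"] by auto
  moreover have "\<bar>x - of_rat (q (g n))\<bar> < 1 / 2 ^ n" "\<bar>y - of_rat (q (g n))\<bar> < 1 / 2 ^ n"
    using assms unfolding represents_def by blast+
  ultimately show False by (simp add: power_divide)
qed

text \<open>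
  The approximations may depend on the oracle, the resulting index does not.
\<close>

lemma mu_clo:
  assumes x: "x \<in> {0..1}"
    and t: "\<And>\<alpha> j. \<alpha> \<in> par T \<Longrightarrow> \<exists>g. eval \<alpha> t [j \<triangleright> e] = Some g \<and> \<bar>x - of_rat (q g)\<bar> < 1 / 2 ^ j"
  shows "\<mu> (clo t e) = x"
proof -
  have rep: "index_represents \<phi> pr q \<mu> (clo t e) x"
    unfolding index_represents_def
  proof
    fix \<alpha> assume "\<alpha> \<in> oracles_of pr \<mu>"
    then have "\<forall>j. \<exists>g. eval \<alpha> t [j \<triangleright> e] = Some g \<and> \<bar>x - of_rat (q g)\<bar> < 1 / 2 ^ j"
      using t par_eq by blast
    from choice[OF this] show "\<exists>g. (\<forall>k. \<phi> \<alpha> (clo t e) k = Some (g k)) \<and> represents q g x"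
      by (auto simp: represents_def)
  qed
  with x have "is_index \<phi> pr q \<mu> (clo t e)"
    unfolding is_index_def by blast
  then have rep': "index_represents \<phi> pr q \<mu> (clo t e) (\<mu> (clo t e))"
    using miller unfolding miller_sequence_def by blast
  \<comment> \<open>One oracle suffices: under it the same function represents both \<open>x\<close>
    and \<open>\<mu> (clo t e)\<close>.\<close>
  obtain \<alpha> where \<alpha>: "\<alpha> \<in> oracles_of pr \<mu>" using par_nonempty par_eq by blast
  obtain g where g: "\<And>k. \<phi> \<alpha> (clo t e) k = Some (g k)" "represents q g x"
    using rep \<alpha> unfolding index_represents_def by blast
  obtain g' where g': "\<And>k. \<phi> \<alpha> (clo t e) k = Some (g' k)" "represents q g' (\<mu> (clo t e))"
    using rep' \<alpha> unfolding index_represents_def by blast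
  have "g = g'" using g(1) g'(1) by auto
  with g(2) g'(2) show ?thesis using represents_unique by blast
qed

definition pvar :: "nat \<Rightarrow> prog" where
  "pvar n = (pweak ^^ n) fst_prog"

lemma eval_pvar_0 [simp]: "eval \<alpha> (pvar 0) [b \<triangleright> e] = Some b"
  by (simp add: pvar_def)

lemma eval_pvar_Suc [simp]: "eval \<alpha> (pvar (Suc n)) [b \<triangleright> e] = eval \<alpha> (pvar n) [e]"
  by (simp add: pvar_def)

definition J :: "real \<Rightarrow> nat set" where
  "J x = {m. \<mu> m = x}"

text \<open>
  The self-application of \<open>n\<close> prepares the diagonal argument in \<open>slices_diagonal\<close>.
\<close>

definition slice_prog :: prog where
  "slice_prog = Comp lo_prog [papp (papp (pvar 1) (pvar 1)) (pvar 2), Comp Succ [Comp Succ [pvar 0]]]"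

definition slice :: "nat \<Rightarrow> nat \<Rightarrow> nat" where
  "slice n k = clo slice_prog (n \<triangleright> k \<triangleright> 0)"

definition pslice :: "prog \<Rightarrow> prog \<Rightarrow> prog" where
  "pslice t u = Comp (plam slice_prog) [Comp enc_prog [t, Comp enc_prog [u, Zero]]]"

lemma eval_pslice [simp]:
  "eval \<alpha> (pslice t u) xs =
     Option.bind (eval \<alpha> t xs) (\<lambda>n. Option.bind (eval \<alpha> u xs) (\<lambda>k. Some (slice n k)))"
  by (cases "eval \<alpha> t xs"; cases "eval \<alpha> u xs") (simp_all add: pslice_def slice_def)

text \<open>The intermediate codes \<open>i\<close> and \<open>m\<close> may vary with the oracle.
  Only the value \<open>x\<close> is common, and this is all that \<open>mu_clo\<close> asks
  for.\<close>

lemma mu_slice: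
  assumes "\<And>\<alpha>. \<alpha> \<in> par T \<Longrightarrow> \<exists>i m. \<phi> \<alpha> n n = Some i \<and> \<phi> \<alpha> i k = Some m \<and> \<mu> m = x"
  shows "\<mu> (slice n k) = x"
  unfolding slice_def
proof (rule mu_clo)
  show "x \<in> {0..1}" using assms par_nonempty mu_bounds by force
next
  fix \<alpha> j assume \<alpha>: "\<alpha> \<in> par T"
  then obtain i m where im: "\<phi> \<alpha> n n = Some i" "\<phi> \<alpha> i k = Some m" "\<mu> m = x"
    using assms by blast
  obtain l where l: "eval \<alpha> lo_prog [m, j + 2] = Some l" "of_rat (q l) < \<mu> m"
    "\<mu> m - of_rat (q l) \<le> 2 / 2 ^ (j + 2)"
    using eval_lo_prog[OF \<alpha>] .
  \<comment> \<open>The bound is read at \<open>j + 2\<close> because at \<open>j + 1\<close> its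
    error is only known to be at most \<open>1 / 2^j\<close>, which is not strict.\<close>
  have "(2 :: real) / 2 ^ (j + 2) < 1 / 2 ^ j" by (simp add: field_simps)
  with l im show "\<exists>g. eval \<alpha> slice_prog [j \<triangleright> n \<triangleright> k \<triangleright> 0] = Some g \<and> \<bar>x - of_rat (q g)\<bar> < 1 / 2 ^ j"
    by (intro exI[of _ l]) (auto simp: slice_prog_def numeral_2_eq_2)
qed

end

section \<open>The Dedekind interval as a quotient of the natural numbers\<close>

text \<open>It will be applied with \<open>l\<close> and \<open>u\<close> saying that the realizer
  sets of the two halves of an internal cut are inhabited.\<close>

lemma classical_cut:
  fixes l u :: "rat \<Rightarrow> bool"
  defines "x \<equiv> Sup {of_rat r | r. l r} :: real"
  assumes ex: "\<exists>r. l r" "\<exists>r. u r"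
    and l: "\<And>r. l r \<longleftrightarrow> (\<exists>y. r < y \<and> l y)"
    and u: "\<And>r. u r \<longleftrightarrow> (\<exists>y. y < r \<and> u y)"
    and disj: "\<And>r. \<not> (l r \<and> u r)"
    and loc: "\<And>r s. r < s \<Longrightarrow> l r \<or> u s"
  shows "l r \<longleftrightarrow> of_rat r < x" "u r \<longleftrightarrow> x < of_rat r"
proof -
  have lu: "r < s" if "l r" "u s" for r s
    using that l disj by (metis linorder_cases)
  obtain s where "u s" using ex by blast
  then have bdd: "bdd_above {of_rat r :: real | r. l r}"
    using lu by (intro bdd_aboveI[of _ "of_rat s"]) (auto simp: of_rat_less_eq less_imp_le)
  have ne: "{of_rat r :: real | r. l r} \<noteq> {}" using ex by blast
  have lx: "l r \<longleftrightarrow> of_rat r < x" for r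
  proof
    assume "l r"
    then obtain y where y: "r < y" "l y" using l by blast
    then have "of_rat y \<le> x" unfolding x_def using bdd by (intro cSup_upper) auto
    with y show "of_rat r < x" by (metis less_le_trans of_rat_less)
  next
    assume "of_rat r < x"
    then obtain y where "l y" "(of_rat r :: real) < of_rat y"
      unfolding x_def using less_cSupD[OF ne] by blast
    then show "l r" using l of_rat_less by blast
  qed
  show "l r \<longleftrightarrow> of_rat r < x" by (rule lx)
  show "u r \<longleftrightarrow> x < of_rat r"
  proof
    assume "u r"
    then obtain y where y: "y < r" "u y" using u by blast
    have "x \<le> of_rat y"
      unfolding x_def using ne lu[OF _ y(2)] by (intro cSup_least) (auto simp: of_rat_less_eq less_imp_le)
    with y show "x < of_rat r" by (metis le_less_trans of_rat_less)
  next
    assume "x < of_rat r"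
    then obtain s where "x < of_rat s" "(of_rat s :: real) < of_rat r"
      using of_rat_dense by blast
    then show "u r" using loc[of s r] lx[of s] by (auto simp: of_rat_less)
  qed
qed

section \<open>Inhabited sets of realizers as truth in the ambient set theory\<close>

context oracle_ppca begin

text \<open>Every element is the value of a constant program, so the rules for \<open>rz\<close>
  become rules for inhabitation. For \<open>rall\<close> only elimination transfers, since a
  realizer has to serve all \<open>y\<close> at once.\<close>

lemma rand_nonempty: "rand T U V \<noteq> {} \<longleftrightarrow> U \<noteq> {} \<and> V \<noteq> {}"
  using rz_nonempty rz_fst rz_snd rz_pair rz_const by (metis ex_in_conv)

lemma rimp_nonempty: "rimp T U V \<noteq> {} \<Longrightarrow> U \<noteq> {} \<Longrightarrow> V \<noteq> {}"
  using rz_nonempty rz_impE rz_const by (metis ex_in_conv)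

lemma rall_nonempty: "rall T \<psi> \<noteq> {} \<Longrightarrow> \<psi> y \<noteq> {}"
  using rz_nonempty rz_allE rz_const by (metis ex_in_conv)

lemma riff_nonempty: "riff T U V \<noteq> {} \<Longrightarrow> U \<noteq> {} \<longleftrightarrow> V \<noteq> {}"
  unfolding riff_def using rand_nonempty rimp_nonempty by metis

lemma rall_riff_nonempty:
  assumes "rall T (\<lambda>r. riff T (U r) (V r)) \<noteq> {}"
  shows "U r \<noteq> {} \<longleftrightarrow> V r \<noteq> {}"
proof (rule riff_nonempty)
  show "riff T (U r) (V r) \<noteq> {}" using rall_nonempty[OF assms, of r] .
qed

lemma rand_memD: "b \<in> rand T U V \<Longrightarrow> U \<noteq> {} \<and> V \<noteq> {}"
  using rand_nonempty[of U V] by blast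

lemma lift_nonempty: "lift b \<noteq> {} \<longleftrightarrow> b"
  by (simp add: lift_def rtop_def rbot_def)

lemma ror_nonempty: "ror T U V \<noteq> {} \<Longrightarrow> U \<noteq> {} \<or> V \<noteq> {}"
  using par_nonempty unfolding ror_def app_in_def by fastforce

lemma all_in_nonempty: "all_in T X \<psi> \<noteq> {} \<Longrightarrow> X x x \<noteq> {} \<Longrightarrow> \<psi> x \<noteq> {}"
  unfolding all_in_def using rall_nonempty rimp_nonempty by metis

lemma ex_in_nonempty: "ex_in T X \<psi> \<noteq> {} \<longleftrightarrow> (\<exists>x. X x x \<noteq> {} \<and> \<psi> x \<noteq> {})"
proof -
  have "ex_in T X \<psi> \<noteq> {} \<longleftrightarrow> (\<exists>x. rand T (X x x) (\<psi> x) \<noteq> {})"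
    unfolding ex_in_def rex_eq by blast
  then show ?thesis by (simp only: rand_nonempty)
qed

text \<open>\<open>Comp\<close> evaluates all its arguments, so the branches are handed to
  \<open>cond_prog\<close> as closures and only the selected one is run on the payload. The
  difference between the tag and \<open>comb_true\<close> is zero exactly on the left.\<close>

lemma rz_or_map:
  assumes t: "rz t e (ror T U V)"
    and u: "\<And>b. b \<in> U \<Longrightarrow> rz u (b \<triangleright> e) U'"
    and v: "\<And>b. b \<in> V \<Longrightarrow> rz v (b \<triangleright> e) V'"
  shows "rz (ppair (pfst t) (papp (Comp cond_prog
           [Comp diff_prog [pfst t, const_prog (comb_true T)], plam u, plam v]) (psnd t))) e (ror T U' V')"
proof (rule rz_orI)
  fix p assume p: "p \<in> par T"
  then obtain c where c: "eval p t [e] = Some c" "c \<in> ror T U V" using t unfolding rz_def by blast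
  then consider (l) b where "\<phi> p c (comb_true T) = Some (comb_true T)" "\<phi> p c (comb_false T) = Some b" "b \<in> U"
    | (r) b where "\<phi> p c (comb_true T) = Some (comb_false T)" "\<phi> p c (comb_false T) = Some b" "b \<in> V"
    using p unfolding ror_def app_in_def app_eq by blast
  then show "\<exists>a b. eval p (pfst t) [e] = Some a \<and>
      eval p (papp (Comp cond_prog
           [Comp diff_prog [pfst t, const_prog (comb_true T)], plam u, plam v]) (psnd t)) [e] = Some b \<and>
      (a = comb_true T \<and> b \<in> U' \<or> a = comb_false T \<and> b \<in> V')"
  proof cases
    case l
    then obtain d where "eval p u [b \<triangleright> e] = Some d" "d \<in> U'" using u p unfolding rz_def by blast
    with l c show ?thesis by (simp add: pfst_def psnd_def)
  next
    case r
    then obtain d where "eval p v [b \<triangleright> e] = Some d" "d \<in> V'" using v p unfolding rz_def by blast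
    with r c true_neq_false show ?thesis by (auto simp: pfst_def psnd_def)
  qed
qed

end

context miller begin

lemma rat_obj_nonempty: "rat_obj q r r \<noteq> {}"
  using q_surj[of r] by (auto simp: rat_obj_def)

lemma all_in_rat_nonempty: "all_in T (rat_obj q) \<psi> \<noteq> {} \<Longrightarrow> \<psi> r \<noteq> {}"
  by (rule all_in_nonempty[where X = "rat_obj q" and x = r, OF _ rat_obj_nonempty])

section \<open>Comparing a coded real with rationals\<close>

definition lower :: "real \<Rightarrow> rat \<Rightarrow> nat set" where
  "lower x r = {k. q k = r \<and> of_rat r < x}"

definition upper :: "real \<Rightarrow> rat \<Rightarrow> nat set" where
  "upper x r = {k. q k = r \<and> x < of_rat r}"

lemma pow2_small:
  assumes "0 < (d :: real)"
  obtains j where "2 / 2 ^ j < d"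
proof -
  obtain j where "(1 / 2) ^ j < d / 2"
    using real_arch_pow_inv[of "d / 2" "1 / 2"] assms by auto
  then show ?thesis by (intro that[of j]) (simp add: power_divide)
qed

lemma rz_J:
  assumes "rz m e (J x)" "\<alpha> \<in> par T"
  obtains n where "eval \<alpha> m [e] = Some n" "\<mu> n = x"
  using assms unfolding rz_def J_def by blast

text \<open>Lower bounds of the coded real are tried at growing precision until one exceeds the
  given rational. \<open>Mu\<close> looks for a zero, so the comparison with 1 by
  \<open>less_prog\<close> serves as negation.\<close>

definition pbelow :: "prog \<Rightarrow> prog \<Rightarrow> prog" where
  "pbelow t m = plet (psearch (Comp less_prog
     [Comp lt_prog [pweak t, Comp lo_prog [pweak m, fst_prog]], const_prog 1]))
     (Comp lo_prog [pweak m, fst_prog])"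

definition pabove :: "prog \<Rightarrow> prog \<Rightarrow> prog" where
  "pabove t m = plet (psearch (Comp less_prog
     [Comp lt_prog [Comp hi_prog [pweak m, fst_prog], pweak t], const_prog 1]))
     (Comp hi_prog [pweak m, fst_prog])"

lemma rz_below:
  assumes t: "rz t e {k. q k = r}" and m: "rz m e (J x)" and x: "of_rat r < x"
  shows "rz (pbelow t m) e {k. r < q k \<and> of_rat (q k) < x}"
  unfolding rz_def
proof
  fix \<alpha> assume \<alpha>: "\<alpha> \<in> par T"
  obtain k where k: "eval \<alpha> t [e] = Some k" "q k = r" using t \<alpha> unfolding rz_def by blast
  obtain n where n: "eval \<alpha> m [e] = Some n" "\<mu> n = x" using rz_J[OF m \<alpha>] .
  have "\<forall>j. \<exists>l. eval \<alpha> lo_prog [n, j] = Some l \<and> of_rat (q l) < x \<and> x - of_rat (q l) \<le> 2 / 2 ^ j"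
    using eval_lo_prog[OF \<alpha>] n by metis
  from choice[OF this] obtain l where l: "\<And>j. eval \<alpha> lo_prog [n, j] = Some (l j)"
    "\<And>j. of_rat (q (l j)) < x" "\<And>j. x - of_rat (q (l j)) \<le> 2 / 2 ^ j" by blast
  obtain i where "2 / 2 ^ i < x - of_rat r" using pow2_small[of "x - of_rat r"] x by auto
  with l(3)[of i] have "(of_rat r :: real) < of_rat (q (l i))" by linarith
  then have i: "(if r < q (l i) then 0 else 1 :: nat) = 0" by (simp add: of_rat_less)
  have "eval \<alpha> (Comp less_prog [Comp lt_prog [pweak t, Comp lo_prog [pweak m, fst_prog]], const_prog 1])
      [j \<triangleright> e] = Some (if r < q (l j) then 0 else 1)" for j
    using k n l by simp
  from eval_psearch_total[OF this i] obtain j where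
    "eval \<alpha> (psearch (Comp less_prog [Comp lt_prog [pweak t, Comp lo_prog [pweak m, fst_prog]], const_prog 1])) [e] = Some j"
    "r < q (l j)" by (auto split: if_splits)
  then show "\<exists>c. eval \<alpha> (pbelow t m) [e] = Some c \<and> c \<in> {k. r < q k \<and> of_rat (q k) < x}"
    using n l by (simp add: pbelow_def)
qed

lemma rz_above:
  assumes t: "rz t e {k. q k = r}" and m: "rz m e (J x)" and x: "x < of_rat r"
  shows "rz (pabove t m) e {k. q k < r \<and> x < of_rat (q k)}"
  unfolding rz_def
proof
  fix \<alpha> assume \<alpha>: "\<alpha> \<in> par T"
  obtain k where k: "eval \<alpha> t [e] = Some k" "q k = r" using t \<alpha> unfolding rz_def by blast
  obtain n where n: "eval \<alpha> m [e] = Some n" "\<mu> n = x" using rz_J[OF m \<alpha>] .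
  have "\<forall>j. \<exists>l. eval \<alpha> hi_prog [n, j] = Some l \<and> x < of_rat (q l) \<and> of_rat (q l) - x \<le> 2 / 2 ^ j"
    using eval_hi_prog[OF \<alpha>] n by metis
  from choice[OF this] obtain l where l: "\<And>j. eval \<alpha> hi_prog [n, j] = Some (l j)"
    "\<And>j. x < of_rat (q (l j))" "\<And>j. of_rat (q (l j)) - x \<le> 2 / 2 ^ j" by blast
  obtain i where "2 / 2 ^ i < of_rat r - x" using pow2_small[of "of_rat r - x"] x by auto
  with l(3)[of i] have "(of_rat (q (l i)) :: real) < of_rat r" by linarith
  then have i: "(if q (l i) < r then 0 else 1 :: nat) = 0" by (simp add: of_rat_less)
  have "eval \<alpha> (Comp less_prog [Comp lt_prog [Comp hi_prog [pweak m, fst_prog], pweak t], const_prog 1])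
      [j \<triangleright> e] = Some (if q (l j) < r then 0 else 1)" for j
    using k n l by simp
  from eval_psearch_total[OF this i] obtain j where
    "eval \<alpha> (psearch (Comp less_prog [Comp lt_prog [Comp hi_prog [pweak m, fst_prog], pweak t], const_prog 1])) [e] = Some j"
    "q (l j) < r" by (auto split: if_splits)
  then show "\<exists>c. eval \<alpha> (pabove t m) [e] = Some c \<and> c \<in> {k. q k < r \<and> x < of_rat (q k)}"
    using n l by (simp add: pabove_def)
qed

definition plocate_test :: "prog \<Rightarrow> prog \<Rightarrow> prog" where
  "plocate_test s m = Comp lt_prog [pweak s, Comp lo_prog [pweak m, fst_prog]]"

definition plocate_search :: "prog \<Rightarrow> prog \<Rightarrow> prog \<Rightarrow> prog" where
  "plocate_search s t m = psearch (Comp less_prog [Comp add_prog [plocate_test s m,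
     Comp lt_prog [Comp hi_prog [pweak m, fst_prog], pweak t]], const_prog 1])"

text \<open>The search is run once for the tag and once for the payload. Under a fixed oracle both
  runs stop at the same \<open>j\<close>, so tag and payload belong together.\<close>

definition plocate :: "prog \<Rightarrow> prog \<Rightarrow> prog \<Rightarrow> prog" where
  "plocate s t m = ppair
     (plet (plocate_search s t m)
       (Comp cond_prog [plocate_test s m, const_prog (comb_false T), const_prog (comb_true T)]))
     (plet (plocate_search s t m)
       (Comp cond_prog [plocate_test s m, pweak t, pweak s]))"

lemma rz_locate:
  assumes s: "rz s e {k. q k = r}" and t: "rz t e {k. q k = r'}" and m: "rz m e (J x)"
    and less: "r < r'"
  shows "rz (plocate s t m) e (ror T (lower x r) (upper x r'))"
  unfolding plocate_def
proof (rule rz_orI)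
  fix \<alpha> assume \<alpha>: "\<alpha> \<in> par T"
  obtain k where k: "eval \<alpha> s [e] = Some k" "q k = r" using s \<alpha> unfolding rz_def by blast
  obtain k' where k': "eval \<alpha> t [e] = Some k'" "q k' = r'" using t \<alpha> unfolding rz_def by blast
  obtain n where n: "eval \<alpha> m [e] = Some n" "\<mu> n = x" using rz_J[OF m \<alpha>] .
  have "\<forall>j. \<exists>l. eval \<alpha> lo_prog [n, j] = Some l \<and> of_rat (q l) < x \<and> x - of_rat (q l) \<le> 2 / 2 ^ j"
    using eval_lo_prog[OF \<alpha>] n by metis
  from choice[OF this] obtain l where l: "\<And>j. eval \<alpha> lo_prog [n, j] = Some (l j)"
    "\<And>j. of_rat (q (l j)) < x" "\<And>j. x - of_rat (q (l j)) \<le> 2 / 2 ^ j" by blast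
  have "\<forall>j. \<exists>l. eval \<alpha> hi_prog [n, j] = Some l \<and> x < of_rat (q l) \<and> of_rat (q l) - x \<le> 2 / 2 ^ j"
    using eval_hi_prog[OF \<alpha>] n by metis
  from choice[OF this] obtain u where u: "\<And>j. eval \<alpha> hi_prog [n, j] = Some (u j)"
    "\<And>j. x < of_rat (q (u j))" "\<And>j. of_rat (q (u j)) - x \<le> 2 / 2 ^ j" by blast
  let ?P = "\<lambda>j. r < q (l j) \<or> q (u j) < r'"
  have "(0::real) < of_rat r' - of_rat r" using less by (simp add: of_rat_less)
  \<comment> \<open>If both tests failed at error \<open>d\<close>, then
    \<open>x - d \<le> r\<close> and \<open>r' \<le> x + d\<close>, so the gap would be at most
    \<open>2 d\<close>; half of the gap as error excludes this.\<close>
  then obtain i where "2 / 2 ^ i < (of_rat r' - of_rat r) / (2::real)"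
    using pow2_small[of "(of_rat r' - of_rat r) / (2::real)"] by auto
  with l(3)[of i] u(3)[of i] have "of_rat r < (of_rat (q (l i)) :: real) \<or> of_rat (q (u i)) < (of_rat r' :: real)"
    by argo
  then have i: "(if ?P i then 0 else 1 :: nat) = 0" by (simp add: of_rat_less)
  have "eval \<alpha> (Comp less_prog [Comp add_prog [plocate_test s m,
     Comp lt_prog [Comp hi_prog [pweak m, fst_prog], pweak t]], const_prog 1])
      [j \<triangleright> e] = Some (if ?P j then 0 else 1)" for j
    using k k' n l u by (simp add: plocate_test_def)
  from eval_psearch_total[OF this i] obtain j where
    j: "eval \<alpha> (plocate_search s t m) [e] = Some j" "?P j"
    unfolding plocate_search_def by (auto split: if_splits)
  have up: "x < of_rat r'" if "\<not> r < q (l j)"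
    using j(2) that u(2)[of j] by (metis less_trans of_rat_less)
  have low: "of_rat r < x" if "r < q (l j)"
    using that l(2)[of j] by (metis less_trans of_rat_less)
  show "\<exists>a b. eval \<alpha> (plet (plocate_search s t m)
       (Comp cond_prog [plocate_test s m, const_prog (comb_false T), const_prog (comb_true T)])) [e] = Some a \<and>
      eval \<alpha> (plet (plocate_search s t m)
       (Comp cond_prog [plocate_test s m, pweak t, pweak s])) [e] = Some b \<and>
      (a = comb_true T \<and> b \<in> lower x r \<or> a = comb_false T \<and> b \<in> upper x r')"
    using j(1) k k' n l(1) up low by (auto simp: plocate_test_def lower_def upper_def)
qed

section \<open>The real number of an internal cut\<close>

abbreviation I :: "(nat, (rat \<Rightarrow> nat set) \<times> (rat \<Rightarrow> nat set)) tobj" where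
  "I \<equiv> unit_interval_obj T q"

text \<open>This forgets the realizers. It is the intended real wherever \<open>dedekind_cut\<close>
  is inhabited, by \<open>dedekind_cut_val\<close>.\<close>

definition cut_val :: "(rat \<Rightarrow> nat set) \<times> (rat \<Rightarrow> nat set) \<Rightarrow> real" where
  "cut_val c = Sup {of_rat r | r. fst c r \<noteq> {}}"

lemma I_eq: "I c c' =
  rand T (rand T
    (rand T (pow_obj T (rat_obj q) (fst c) (fst c')) (pow_obj T (rat_obj q) (snd c) (snd c')))
    (dedekind_cut T q c))
    (rand T (real_le T q (rat_cut T q 0) c) (real_le T q c (rat_cut T q 1)))"
  by (cases c; cases c') (simp add: unit_interval_obj_def real_obj_def sub_obj_def prod_obj_def)

lemma dedekind_cut_val:
  assumes "dedekind_cut T q c \<noteq> {}"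
  shows "fst c r \<noteq> {} \<longleftrightarrow> of_rat r < cut_val c" "snd c r \<noteq> {} \<longleftrightarrow> cut_val c < of_rat r"
proof -
  obtain L U where c: "c = (L, U)" by (cases c)
  have d:
    "ex_in T (rat_obj q) L \<noteq> {}" "ex_in T (rat_obj q) U \<noteq> {}"
    "all_in T (rat_obj q) (\<lambda>x. riff T (L x) (ex_in T (rat_obj q) (\<lambda>y. rand T (lift (x < y)) (L y)))) \<noteq> {}"
    "all_in T (rat_obj q) (\<lambda>y. riff T (U y) (ex_in T (rat_obj q) (\<lambda>x. rand T (lift (x < y)) (U x)))) \<noteq> {}"
    "all_in T (rat_obj q) (\<lambda>x. rimp T (rand T (L x) (U x)) rbot) \<noteq> {}"
    "all_in T (rat_obj q) (\<lambda>x. all_in T (rat_obj q) (\<lambda>y. rimp T (lift (x < y)) (ror T (L x) (U y)))) \<noteq> {}"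
    using assms unfolding c dedekind_cut_def prod.case rand_nonempty by simp_all
  note ne = rat_obj_nonempty
  have 1: "\<exists>r. L r \<noteq> {}" "\<exists>r. U r \<noteq> {}"
    using d(1,2) unfolding ex_in_nonempty by blast+
  have 2: "L r \<noteq> {} \<longleftrightarrow> (\<exists>y. r < y \<and> L y \<noteq> {})" for r
    using riff_nonempty[OF all_in_nonempty[OF d(3) ne[of r]]]
    unfolding ex_in_nonempty rand_nonempty lift_nonempty using ne by simp
  have 3: "U r \<noteq> {} \<longleftrightarrow> (\<exists>y. y < r \<and> U y \<noteq> {})" for r
    using riff_nonempty[OF all_in_nonempty[OF d(4) ne[of r]]]
    unfolding ex_in_nonempty rand_nonempty lift_nonempty using ne by simp
  have 4: "\<not> (L r \<noteq> {} \<and> U r \<noteq> {})" for r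
    using rimp_nonempty[OF all_in_nonempty[OF d(5) ne[of r]]]
    unfolding rand_nonempty rbot_def by blast
  have 5: "L r \<noteq> {} \<or> U s \<noteq> {}" if "r < s" for r s
    using ror_nonempty[OF rimp_nonempty[OF all_in_nonempty[OF all_in_nonempty[OF d(6) ne[of r]] ne[of s]]]] that
    unfolding lift_nonempty by blast
  have cut: "L r \<noteq> {} \<longleftrightarrow> of_rat r < cut_val c" "U r \<noteq> {} \<longleftrightarrow> cut_val c < of_rat r"
    unfolding c cut_val_def fst_conv
    by (rule classical_cut[where l = "\<lambda>r. L r \<noteq> {}" and u = "\<lambda>r. U r \<noteq> {}"];
        (fact 1 2 3 4 | erule 5))+
  then show "fst c r \<noteq> {} \<longleftrightarrow> of_rat r < cut_val c" "snd c r \<noteq> {} \<longleftrightarrow> cut_val c < of_rat r"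
    unfolding c by simp_all
qed

lemma cut_val_eqI:
  assumes "\<And>r. fst c r \<noteq> {} \<longleftrightarrow> fst c' r \<noteq> {}"
  shows "cut_val c = cut_val c'"
  unfolding cut_val_def assms ..

lemma cut_val_canonical:
  assumes "\<And>r. fst c r \<noteq> {} \<longleftrightarrow> of_rat r < x"
  shows "cut_val c = x"
  unfolding cut_val_def assms
proof (rule cSup_eq_non_empty)
  obtain r where "(of_rat r :: real) < x" using of_rat_dense[of "x - 1" x] by auto
  then show "{of_rat r | r. (of_rat r :: real) < x} \<noteq> {}" by blast
  show "x \<le> y" if y: "\<And>z. z \<in> {of_rat r | r. (of_rat r :: real) < x} \<Longrightarrow> z \<le> y" for y
  proof (rule ccontr)
    assume "\<not> x \<le> y"
    then obtain r where "y < of_rat r" "(of_rat r :: real) < x" using of_rat_dense[of y x] by auto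
    with y show False by force
  qed
qed auto

text \<open>The two inequalities with \<open>rat_cut\<close> put every rational below 0 into the
  lower half and every rational above 1 into the upper half, which bounds the value. The halves of
  \<open>c'\<close> are inhabited exactly where those of \<open>c\<close> are.\<close>

lemma I_val:
  assumes "I c c' \<noteq> {}"
  shows "cut_val c \<in> {0..1}" "cut_val c' = cut_val c"
    "fst c r \<noteq> {} \<longleftrightarrow> of_rat r < cut_val c" "snd c r \<noteq> {} \<longleftrightarrow> cut_val c < of_rat r"
    "fst c' r \<noteq> {} \<longleftrightarrow> of_rat r < cut_val c" "snd c' r \<noteq> {} \<longleftrightarrow> cut_val c < of_rat r"
proof -
  have d: "dedekind_cut T q c \<noteq> {}"
    "pow_obj T (rat_obj q) (fst c) (fst c') \<noteq> {}" "pow_obj T (rat_obj q) (snd c) (snd c') \<noteq> {}"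
    "real_le T q (rat_cut T q 0) c \<noteq> {}" "real_le T q c (rat_cut T q 1) \<noteq> {}"
    using assms unfolding I_eq rand_nonempty by blast+
  note cut = dedekind_cut_val[OF d(1)]
  show "fst c r \<noteq> {} \<longleftrightarrow> of_rat r < cut_val c" "snd c r \<noteq> {} \<longleftrightarrow> cut_val c < of_rat r"
    by (rule cut)+
  have eq: "fst c r \<noteq> {} \<longleftrightarrow> fst c' r \<noteq> {}" "snd c r \<noteq> {} \<longleftrightarrow> snd c' r \<noteq> {}" for r
    using rall_riff_nonempty[of "fst c" "fst c'" r] rall_riff_nonempty[of "snd c" "snd c'" r] d(2,3)
    unfolding pow_obj_def rand_nonempty by simp_all
  show "cut_val c' = cut_val c" by (rule cut_val_eqI) (simp only: eq)
  show "fst c' r \<noteq> {} \<longleftrightarrow> of_rat r < cut_val c" "snd c' r \<noteq> {} \<longleftrightarrow> cut_val c < of_rat r"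
    using cut[of r] eq[of r] by simp_all
  have zero: "of_rat r < cut_val c" if "r < 0" for r
  proof -
    have "all_in T (rat_obj q) (\<lambda>r. rimp T (fst (rat_cut T q 0) r) (fst c r)) \<noteq> {}"
      using d(4) unfolding real_le_def rand_nonempty by blast
    from all_in_rat_nonempty[OF this, of r]
    have "rimp T (fst (rat_cut T q 0) r) (fst c r) \<noteq> {}" .
    moreover have "fst (rat_cut T q 0) r \<noteq> {}"
      unfolding rat_cut_def fst_conv rand_nonempty lift_nonempty using that rat_obj_nonempty by simp
    ultimately have "fst c r \<noteq> {}"
      by (rule rimp_nonempty)
    then show ?thesis using cut by blast
  qed
  have one: "cut_val c < of_rat r" if "1 < r" for r
  proof -
    have "all_in T (rat_obj q) (\<lambda>r. rimp T (snd (rat_cut T q 1) r) (snd c r)) \<noteq> {}"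
      using d(5) unfolding real_le_def rand_nonempty by blast
    from all_in_rat_nonempty[OF this, of r]
    have "rimp T (snd (rat_cut T q 1) r) (snd c r) \<noteq> {}" .
    moreover have "snd (rat_cut T q 1) r \<noteq> {}"
      unfolding rat_cut_def snd_conv rand_nonempty lift_nonempty using that rat_obj_nonempty by simp
    ultimately have "snd c r \<noteq> {}"
      by (rule rimp_nonempty)
    then show ?thesis using cut by blast
  qed
  show "cut_val c \<in> {0..1}"
    unfolding atLeastAtMost_iff
  proof (intro conjI; rule ccontr)
    assume "\<not> 0 \<le> cut_val c"
    then obtain r where "cut_val c < of_rat r" "(of_rat r :: real) < 0"
      using of_rat_dense[of "cut_val c" 0] by auto
    with zero[of r] show False by (simp add: of_rat_less_0_iff)
  next
    assume "\<not> cut_val c \<le> 1"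
    then obtain r where "1 < (of_rat r :: real)" "of_rat r < cut_val c"
      using of_rat_dense[of 1 "cut_val c"] by auto
    with one[of r] show False by simp
  qed
qed

text \<open>
  Evidence that the cut \<open>c\<close> is the canonical cut of \<open>x\<close>, together with a code of \<open>x\<close>. It can be
  exchanged for the existence of \<open>c\<close> in the interval, in both directions.
\<close>

definition K :: "(rat \<Rightarrow> nat set) \<times> (rat \<Rightarrow> nat set) \<Rightarrow> real \<Rightarrow> nat set" where
  "K c x = rand T (J x)
     (rand T (rall T (\<lambda>r. riff T (fst c r) (lower x r))) (rall T (\<lambda>r. riff T (snd c r) (upper x r))))"

lemma K_J: "rz t e (K c x) \<Longrightarrow> rz (pfst t) e (J x)"
  unfolding K_def by (rule rz_fst)

lemma K_lower:
  assumes "rz t e (K c x)"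
  shows "rz (pspec (pfst (psnd t))) e (riff T (fst c r) (lower x r))"
  using assms unfolding K_def
  by (intro rz_allE[where \<psi> = "\<lambda>r. riff T (fst c r) (lower x r)"]) (rule rz_fst[OF rz_snd])

lemma K_upper:
  assumes "rz t e (K c x)"
  shows "rz (pspec (psnd (psnd t))) e (riff T (snd c r) (upper x r))"
  using assms unfolding K_def
  by (intro rz_allE[where \<psi> = "\<lambda>r. riff T (snd c r) (upper x r)"]) (rule rz_snd[OF rz_snd])

lemmas K_lowerD = rz_impE[OF rz_fst[OF K_lower[unfolded riff_def]]]
lemmas K_lowerI = rz_impE[OF rz_snd[OF K_lower[unfolded riff_def]]]
lemmas K_upperD = rz_impE[OF rz_fst[OF K_upper[unfolded riff_def]]]
lemmas K_upperI = rz_impE[OF rz_snd[OF K_upper[unfolded riff_def]]]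

lemma K_val:
  assumes "K c x \<noteq> {}"
  shows "fst c r \<noteq> {} \<longleftrightarrow> of_rat r < x" "snd c r \<noteq> {} \<longleftrightarrow> x < of_rat r" "cut_val c = x"
proof -
  have "rall T (\<lambda>r. riff T (fst c r) (lower x r)) \<noteq> {}" "rall T (\<lambda>r. riff T (snd c r) (upper x r)) \<noteq> {}"
    using assms unfolding K_def rand_nonempty by blast+
  then have *: "fst c r \<noteq> {} \<longleftrightarrow> lower x r \<noteq> {}" "snd c r \<noteq> {} \<longleftrightarrow> upper x r \<noteq> {}" for r
    using rall_riff_nonempty[of "fst c" "lower x" r] rall_riff_nonempty[of "snd c" "upper x" r] by simp_all
  have **: "fst c r \<noteq> {} \<longleftrightarrow> of_rat r < x" "snd c r \<noteq> {} \<longleftrightarrow> x < of_rat r" for r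
    unfolding * using q_surj[of r] by (auto simp: lower_def upper_def)
  show "fst c r \<noteq> {} \<longleftrightarrow> of_rat r < x" "snd c r \<noteq> {} \<longleftrightarrow> x < of_rat r" by (rule **)+
  show "cut_val c = x" by (rule cut_val_canonical) (rule **)
qed

text \<open>
  Uniform derivability is stated as the existence of a program transformer \<open>f\<close> in front of all
  other quantifiers.
\<close>

lemma K_strict_lower:
  "\<exists>f. \<forall>c x t e. rz t e (K c x) \<longrightarrow> rz (f t) e (strict_extensional T (rat_obj q) (fst c))"
  apply (rule exI, intro allI impI)
  unfolding strict_extensional_def
  apply (rule rz_pair)
   apply (rule rz_allI, rule rz_impI)
   apply (rule rz_mono)
    apply (rule K_lowerD[OF rz_weak rz_here], assumption, assumption)
   apply (simp add: lower_def rat_obj_def Collect_mono)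
  apply (rule rz_allI, rule rz_allI, rule rz_impI)
  apply (rule rz_mono)
   apply (rule rz_fst[OF rz_here], assumption)
  apply (auto dest!: rand_memD simp: rat_obj_def)
  done

lemma K_mem:
  assumes "rz t e (K c x)"
  shows "b \<in> fst c r \<Longrightarrow> of_rat r < x" "b \<in> snd c r \<Longrightarrow> x < of_rat r"
  using K_val(1,2)[OF rz_nonempty[OF assms], of r] by blast+

lemma K_ex_mem:
  assumes "rz t e (K c x)"
  shows "b \<in> ex_in T (rat_obj q) (\<lambda>y. rand T (lift (r < y)) (fst c y)) \<Longrightarrow> of_rat r < x"
    "b \<in> ex_in T (rat_obj q) (\<lambda>y. rand T (lift (y < r)) (snd c y)) \<Longrightarrow> x < of_rat r"
proof -
  assume "b \<in> ex_in T (rat_obj q) (\<lambda>y. rand T (lift (r < y)) (fst c y))"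
  then have "ex_in T (rat_obj q) (\<lambda>y. rand T (lift (r < y)) (fst c y)) \<noteq> {}" by blast
  then obtain y where "r < y" "fst c y \<noteq> {}"
    unfolding ex_in_nonempty rand_nonempty lift_nonempty by blast
  then show "of_rat r < x"
    using K_val(1)[OF rz_nonempty[OF assms], of y] by (metis less_trans of_rat_less)
next
  assume "b \<in> ex_in T (rat_obj q) (\<lambda>y. rand T (lift (y < r)) (snd c y))"
  then have "ex_in T (rat_obj q) (\<lambda>y. rand T (lift (y < r)) (snd c y)) \<noteq> {}" by blast
  then obtain y where "y < r" "snd c y \<noteq> {}"
    unfolding ex_in_nonempty rand_nonempty lift_nonempty by blast
  then show "x < of_rat r"
    using K_val(2)[OF rz_nonempty[OF assms], of y] by (metis less_trans of_rat_less)
qed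

lemma rz_lo:
  assumes "rz m e (J x)"
  shows "rz (Comp lo_prog [m, Zero]) e {k. of_rat (q k) < x}"
  unfolding rz_def
proof
  fix \<alpha> assume \<alpha>: "\<alpha> \<in> par T"
  obtain n where n: "eval \<alpha> m [e] = Some n" "\<mu> n = x" using rz_J[OF assms \<alpha>] .
  show "\<exists>c. eval \<alpha> (Comp lo_prog [m, Zero]) [e] = Some c \<and> c \<in> {k. of_rat (q k) < x}"
    using n by (auto intro: eval_lo_prog[OF \<alpha>, of n 0])
qed

lemma rz_hi:
  assumes "rz m e (J x)"
  shows "rz (Comp hi_prog [m, Zero]) e {k. x < of_rat (q k)}"
  unfolding rz_def
proof
  fix \<alpha> assume \<alpha>: "\<alpha> \<in> par T"
  obtain n where n: "eval \<alpha> m [e] = Some n" "\<mu> n = x" using rz_J[OF assms \<alpha>] .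
  show "\<exists>c. eval \<alpha> (Comp hi_prog [m, Zero]) [e] = Some c \<and> c \<in> {k. x < of_rat (q k)}"
    using n by (auto intro: eval_hi_prog[OF \<alpha>, of n 0])
qed

lemma rz_ex_rat:
  assumes "rz t e S" "\<And>k. k \<in> S \<Longrightarrow> rz u (k \<triangleright> e) (\<psi> (q k))"
  shows "rz (plet t (ppair fst_prog u)) e (ex_in T (rat_obj q) \<psi>)"
  using assms(1)
proof (rule rz_let)
  fix k assume k: "k \<in> S"
  show "rz (ppair fst_prog u) (k \<triangleright> e) (ex_in T (rat_obj q) \<psi>)"
    by (rule rz_ex_inI[where x = "q k"], rule rz_here) (simp_all add: rat_obj_def assms(2) k)
qed

lemma K_strict_upper:
  "\<exists>f. \<forall>c x t e. rz t e (K c x) \<longrightarrow> rz (f t) e (strict_extensional T (rat_obj q) (snd c))"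
  apply (rule exI, intro allI impI)
  unfolding strict_extensional_def
  apply (rule rz_pair)
   apply (rule rz_allI, rule rz_impI)
   apply (rule rz_mono)
    apply (rule K_upperD[OF rz_weak rz_here], assumption, assumption)
   apply (simp add: upper_def rat_obj_def Collect_mono)
  apply (rule rz_allI, rule rz_allI, rule rz_impI)
  apply (rule rz_mono)
   apply (rule rz_fst[OF rz_here], assumption)
  apply (auto dest!: rand_memD simp: rat_obj_def)
  done

lemma K_lower_inhabited:
  "\<exists>f. \<forall>c x t e. rz t e (K c x) \<longrightarrow> rz (f t) e (ex_in T (rat_obj q) (fst c))"
  apply (rule exI, intro allI impI)
  apply (rule rz_ex_rat[OF rz_lo[OF K_J]], assumption)
  apply (rule K_lowerI[OF rz_weak rz_here], assumption)
  apply (simp add: lower_def)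
  done

lemma K_upper_inhabited:
  "\<exists>f. \<forall>c x t e. rz t e (K c x) \<longrightarrow> rz (f t) e (ex_in T (rat_obj q) (snd c))"
  apply (rule exI, intro allI impI)
  apply (rule rz_ex_rat[OF rz_hi[OF K_J]], assumption)
  apply (rule K_upperI[OF rz_weak rz_here], assumption)
  apply (simp add: upper_def)
  done

text \<open>Only the forward direction needs a search, done by \<open>rz_below\<close>. Backwards,
  the index of \<open>r\<close> is already a realizer of \<open>lower x r\<close>.\<close>

lemma K_lower_rounded:
  "\<exists>f. \<forall>c x t e. rz t e (K c x) \<longrightarrow> rz (f t) e (all_in T (rat_obj q) (\<lambda>r.
     riff T (fst c r) (ex_in T (rat_obj q) (\<lambda>y. rand T (lift (r < y)) (fst c y)))))"
  apply (rule exI, intro allI impI)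
  apply (rule rz_all_inI)
  unfolding riff_def
  apply (rule rz_pair)
   apply (rule rz_impI)
   apply (rule rz_ex_rat)
    apply (rule rz_below)
      apply (rule rz_weak[OF rz_here], simp add: rat_obj_def)
     apply (rule rz_weak[OF rz_weak[OF K_J]], assumption)
    apply (erule K_mem, assumption)
   apply (rule rz_pair)
    apply (rule rz_lift, simp)
   apply (rule K_lowerI[OF rz_weak[OF rz_weak[OF rz_weak]] rz_here], assumption)
   apply (simp add: lower_def)
  apply (rule rz_impI)
  apply (rule K_lowerI[OF rz_weak[OF rz_weak] rz_weak[OF rz_here]], assumption)
  apply (simp add: lower_def rat_obj_def K_ex_mem)
  done

lemma K_upper_rounded:
  "\<exists>f. \<forall>c x t e. rz t e (K c x) \<longrightarrow> rz (f t) e (all_in T (rat_obj q) (\<lambda>r.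
     riff T (snd c r) (ex_in T (rat_obj q) (\<lambda>y. rand T (lift (y < r)) (snd c y)))))"
  apply (rule exI, intro allI impI)
  apply (rule rz_all_inI)
  unfolding riff_def
  apply (rule rz_pair)
   apply (rule rz_impI)
   apply (rule rz_ex_rat)
    apply (rule rz_above)
      apply (rule rz_weak[OF rz_here], simp add: rat_obj_def)
     apply (rule rz_weak[OF rz_weak[OF K_J]], assumption)
    apply (erule K_mem, assumption)
   apply (rule rz_pair)
    apply (rule rz_lift, simp)
   apply (rule K_upperI[OF rz_weak[OF rz_weak[OF rz_weak]] rz_here], assumption)
   apply (simp add: upper_def)
  apply (rule rz_impI)
  apply (rule K_upperI[OF rz_weak[OF rz_weak] rz_weak[OF rz_here]], assumption)
  apply (simp add: upper_def rat_obj_def K_ex_mem)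
  done

text \<open>The two halves are never both inhabited at \<open>r\<close>, so the premise has no
  realizer and 0 stands for an arbitrary output.\<close>

lemma K_disjoint:
  "\<exists>f. \<forall>c x t e. rz t e (K c x) \<longrightarrow> rz (f t) e (all_in T (rat_obj q) (\<lambda>r.
     rimp T (rand T (fst c r) (snd c r)) rbot))"
  apply (rule exI, intro allI impI)
  apply (rule rz_all_inI, rule rz_impI, rule rz_const[of 0])
  apply (drule rand_memD)
  apply (drule rz_nonempty)
  apply (auto simp: K_val)
  done

text \<open>The decision is made on the coded real by \<open>plocate\<close>; each alternative is
  then carried from \<open>lower x\<close> or \<open>upper x\<close> to the corresponding half of
  \<open>c\<close>.\<close>

lemma K_located:
  "\<exists>f. \<forall>c x t e. rz t e (K c x) \<longrightarrow> rz (f t) e (all_in T (rat_obj q) (\<lambda>r.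
     all_in T (rat_obj q) (\<lambda>s. rimp T (lift (r < s)) (ror T (fst c r) (snd c s)))))"
  apply (rule exI, intro allI impI)
  apply (rule rz_all_inI, rule rz_all_inI, rule rz_impI)
  apply (rule rz_or_map)
    apply (rule rz_locate)
       apply (rule rz_weak[OF rz_weak[OF rz_here]], simp add: rat_obj_def)
      apply (rule rz_weak[OF rz_here], simp add: rat_obj_def)
     apply (rule rz_weak[OF rz_weak[OF rz_weak[OF K_J]]], assumption)
    apply (simp add: lift_def rbot_def split: if_splits)
   apply (rule K_lowerI[OF rz_weak[OF rz_weak[OF rz_weak[OF rz_weak]]] rz_here], assumption, assumption)
  apply (rule K_upperI[OF rz_weak[OF rz_weak[OF rz_weak[OF rz_weak]]] rz_here], assumption, assumption)
  done

lemma dedekind_cut_eq: "dedekind_cut T q c =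
     rand T (ex_in T (rat_obj q) (fst c))
    (rand T (ex_in T (rat_obj q) (snd c))
    (rand T (all_in T (rat_obj q) (\<lambda>x.
               riff T (fst c x) (ex_in T (rat_obj q) (\<lambda>y. rand T (lift (x < y)) (fst c y)))))
    (rand T (all_in T (rat_obj q) (\<lambda>y.
               riff T (snd c y) (ex_in T (rat_obj q) (\<lambda>x. rand T (lift (x < y)) (snd c x)))))
    (rand T (all_in T (rat_obj q) (\<lambda>x. rimp T (rand T (fst c x) (snd c x)) rbot))
            (all_in T (rat_obj q) (\<lambda>x. all_in T (rat_obj q) (\<lambda>y.
               rimp T (lift (x < y)) (ror T (fst c x) (snd c y)))))))))"
  by (simp add: dedekind_cut_def split_beta)

lemma K_dedekind_cut:
  "\<exists>f. \<forall>c x t e. rz t e (K c x) \<longrightarrow> rz (f t) e (dedekind_cut T q c)"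
proof -
  \<comment> \<open>Choice turns each existence statement into a named transformer, and the
    transformer to be exhibited is composed of these.\<close>
  note parts = K_lower_inhabited[THEN someI_ex, rule_format] K_upper_inhabited[THEN someI_ex, rule_format]
    K_lower_rounded[THEN someI_ex, rule_format] K_upper_rounded[THEN someI_ex, rule_format]
    K_disjoint[THEN someI_ex, rule_format] K_located[THEN someI_ex, rule_format]
  show ?thesis
    unfolding dedekind_cut_eq
    apply (rule exI, intro allI impI)
    apply ((rule parts, assumption) | rule rz_pair)+
    done
qed

lemma K_unit_bounds:
  "\<exists>f. \<forall>c x t e. x \<in> {0..1} \<longrightarrow> rz t e (K c x) \<longrightarrow>
     rz (f t) e (rand T (real_le T q (rat_cut T q 0) c) (real_le T q c (rat_cut T q 1)))"
  apply (rule exI, intro allI impI)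
  unfolding real_le_def rat_cut_def fst_conv snd_conv
  apply (rule rz_pair)
   apply (rule rz_pair)
    apply (rule rz_all_inI, rule rz_impI)
    apply (rule K_lowerI[OF rz_weak[OF rz_weak] rz_weak[OF rz_here]], assumption)
    apply (drule rand_memD)
    apply (force simp: lift_nonempty lower_def rat_obj_def intro: less_le_trans[of _ 0])
   apply (rule rz_all_inI, rule rz_impI)
   apply (rule rz_pair)
    apply (rule rz_weak[OF rz_here], assumption)
   apply (rule rz_lift)
   apply (drule K_mem(2), assumption)
   apply (auto dest: le_less_trans)[1]
  apply (rule rz_pair)
   apply (rule rz_all_inI, rule rz_impI)
   apply (rule rz_pair)
    apply (rule rz_weak[OF rz_here], assumption)
   apply (rule rz_lift)
   apply (drule K_mem(1), assumption)
   apply (auto dest: less_le_trans)[1]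
  apply (rule rz_all_inI, rule rz_impI)
  apply (rule K_upperI[OF rz_weak[OF rz_weak] rz_weak[OF rz_here]], assumption)
  apply (drule rand_memD)
  apply (force simp: lift_nonempty upper_def rat_obj_def intro: le_less_trans[of _ 1])
  done

text \<open>The equivalences pass through \<open>lower x\<close> and \<open>upper x\<close>, which
  depend on the value alone.\<close>

lemma K_equal:
  "\<exists>f. \<forall>c c' x t u e. rz t e (K c x) \<longrightarrow> rz u e (K c' x) \<longrightarrow>
     rz (f t u) e (rand T (rall T (\<lambda>r. riff T (fst c r) (fst c' r)))
                           (rall T (\<lambda>r. riff T (snd c r) (snd c' r))))"
  apply (rule exI, intro allI impI)
  unfolding riff_def
  apply (rule rz_pair)
   apply (rule rz_allI, rule rz_pair)
    apply (rule rz_impI)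
    apply (rule K_lowerI, rule rz_weak, assumption)
    apply (rule K_lowerD[OF rz_weak rz_here], assumption, assumption)
   apply (rule rz_impI)
   apply (rule K_lowerI, rule rz_weak, assumption)
   apply (rule K_lowerD[OF rz_weak rz_here], assumption, assumption)
  apply (rule rz_allI, rule rz_pair)
   apply (rule rz_impI)
   apply (rule K_upperI, rule rz_weak, assumption)
   apply (rule K_upperD[OF rz_weak rz_here], assumption, assumption)
  apply (rule rz_impI)
  apply (rule K_upperI, rule rz_weak, assumption)
  apply (rule K_upperD[OF rz_weak rz_here], assumption, assumption)
  done

lemma I_if_K:
  "\<exists>f. \<forall>c c' x t u e. x \<in> {0..1} \<longrightarrow> rz t e (K c x) \<longrightarrow> rz u e (K c' x) \<longrightarrow>
     rz (f t u) e (I c c')"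
proof -
  note parts = K_strict_lower[THEN someI_ex, rule_format] K_strict_upper[THEN someI_ex, rule_format]
    K_dedekind_cut[THEN someI_ex, rule_format]
  note unit = K_unit_bounds[THEN someI_ex, rule_format]
  note equal = K_equal[THEN someI_ex, rule_format]
  show ?thesis
    unfolding I_eq pow_obj_def
    apply (rule exI, intro allI impI)
    apply (rule rz_pair, rule rz_pair, rule rz_pair)
       apply (rule rz_pair, rule parts, assumption, rule rz_fst[OF equal], assumption, assumption)
      apply (rule rz_pair, rule parts, assumption, rule rz_snd[OF equal], assumption, assumption)
     apply (rule parts, assumption)
    apply (rule unit, assumption, assumption)
    done
qed

section \<open>From points of the interval to indices\<close>

definition plocated :: "prog \<Rightarrow> prog \<Rightarrow> prog \<Rightarrow> prog" where
  "plocated t s u = papp (papp (pspec (papp (pspec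
     (psnd (psnd (psnd (psnd (psnd (psnd (pfst t)))))))) s)) u) (const_prog 0)"

lemma rz_located:
  assumes t: "rz t e (I c c')" and s: "rz s e {k. q k = r}" and u: "rz u e {k. q k = r'}"
    and less: "r < r'"
  shows "rz (plocated t s u) e (ror T (fst c r) (snd c r'))"
proof -
  have 1: "rz (psnd (psnd (psnd (psnd (psnd (psnd (pfst t))))))) e
     (all_in T (rat_obj q) (\<lambda>x. all_in T (rat_obj q) (\<lambda>y.
               rimp T (lift (x < y)) (ror T (fst c x) (snd c y)))))"
    using t unfolding I_eq dedekind_cut_eq by (intro rz_snd rz_fst) assumption
  have s': "rz s e (rat_obj q r r)" and u': "rz u e (rat_obj q r' r')"
    using s u by (simp_all add: rat_obj_def)
  from rz_all_inE[OF rz_all_inE[OF 1 s'] u'] rz_lift[of "r < r'"] less show ?thesis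
    unfolding plocated_def by (blast intro: rz_impE)
qed

lemma rz_strict_lower:
  assumes "rz t e (I c c')" "rz u e (fst c r)"
  shows "rz (papp (pspec (pfst (pfst (pfst (pfst (pfst t)))))) u) e (rat_obj q r r)"
proof -
  have "rz (pfst (pfst (pfst (pfst (pfst t))))) e (rall T (\<lambda>r. rimp T (fst c r) (rat_obj q r r)))"
    using assms(1) unfolding I_eq pow_obj_def strict_extensional_def by (intro rz_fst) assumption
  from rz_impE[OF rz_allE[OF this, of r] assms(2)] show ?thesis .
qed

lemma rz_strict_upper:
  assumes "rz t e (I c c')" "rz u e (snd c r)"
  shows "rz (papp (pspec (pfst (pfst (psnd (pfst (pfst t)))))) u) e (rat_obj q r r)"
proof -
  have "rz (pfst (pfst (psnd (pfst (pfst t))))) e (rall T (\<lambda>r. rimp T (snd c r) (rat_obj q r r)))"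
    using assms(1) unfolding I_eq pow_obj_def strict_extensional_def by (intro rz_fst rz_snd) assumption
  from rz_impE[OF rz_allE[OF this, of r] assms(2)] show ?thesis .
qed

lemma rz_equal_lower:
  assumes "rz t e (I c c')"
  shows "rz (pspec (psnd (pfst (pfst (pfst t))))) e (riff T (fst c r) (fst c' r))"
proof -
  have "rz (psnd (pfst (pfst (pfst t)))) e (rall T (\<lambda>r. riff T (fst c r) (fst c' r)))"
    using assms(1) unfolding I_eq pow_obj_def by (intro rz_fst rz_snd) assumption
  from rz_allE[OF this, of r] show ?thesis .
qed

lemma rz_equal_upper:
  assumes "rz t e (I c c')"
  shows "rz (pspec (psnd (psnd (pfst (pfst t))))) e (riff T (snd c r) (snd c' r))"
proof -
  have "rz (psnd (psnd (pfst (pfst t)))) e (rall T (\<lambda>r. riff T (snd c r) (snd c' r)))"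
    using assms(1) unfolding I_eq pow_obj_def by (intro rz_fst rz_snd) assumption
  from rz_allE[OF this, of r] show ?thesis .
qed

text \<open>
  A point of the interval is approximated by the first grid point \<open>i / 2 ^ Suc j\<close> at which
  locatedness decides for the upper cut of the successor; it exists as the lower cut does not contain 1.
\<close>

definition pgrid :: "prog \<Rightarrow> prog \<Rightarrow> prog" where
  "pgrid i j = Comp frac_prog [i, Zero, Comp pow2_prog [Comp Succ [j]]]"

lemma eval_pgrid:
  assumes "eval \<alpha> i [e] = Some m" "eval \<alpha> j [e] = Some n"
  obtains k where "eval \<alpha> (pgrid i j) [e] = Some k" "q k = of_nat m / 2 ^ Suc n"
proof -
  obtain k where "eval \<alpha> frac_prog [m, 0, 2 ^ Suc n] = Some k"
    "q k = (of_nat m - of_nat 0) / of_nat (2 ^ Suc n)"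
    using eval_frac_prog[of "2 ^ Suc n" \<alpha> m 0] by auto
  with assms show ?thesis by (intro that[of k]) (simp_all add: pgrid_def)
qed

lemma rz_pgrid:
  assumes "\<And>\<alpha>. eval \<alpha> i [e] = Some m" "\<And>\<alpha>. eval \<alpha> j [e] = Some n"
  shows "rz (pgrid i j) e {k. q k = of_nat m / 2 ^ Suc n}"
  unfolding rz_def using eval_pgrid[OF assms] by blast

definition pgrid_cell :: "prog \<Rightarrow> prog" where
  "pgrid_cell t = plocated (pweak (pweak t)) (pgrid (pvar 0) (pvar 1)) (pgrid (Comp Succ [pvar 0]) (pvar 1))"

definition papprox :: "prog \<Rightarrow> prog" where
  "papprox t = plet (psearch (Comp diff_prog [pfst (pgrid_cell t), const_prog (comb_false T)]))
     (pgrid (pvar 0) (pvar 1))"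

lemma rz_grid_cell:
  assumes "rz t e (I c c')"
  shows "rz (pgrid_cell t) (i \<triangleright> j \<triangleright> e)
    (ror T (fst c (of_nat i / 2 ^ Suc j)) (snd c (of_nat (Suc i) / 2 ^ Suc j)))"
  unfolding pgrid_cell_def
proof (rule rz_located)
  show "rz (pweak (pweak t)) (i \<triangleright> j \<triangleright> e) (I c c')"
    by (intro rz_weak assms)
  show "rz (pgrid (pvar 0) (pvar 1)) (i \<triangleright> j \<triangleright> e) {k. q k = of_nat i / 2 ^ Suc j}"
    by (rule rz_pgrid) simp_all
  show "rz (pgrid (Comp Succ [pvar 0]) (pvar 1)) (i \<triangleright> j \<triangleright> e) {k. q k = of_nat (Suc i) / 2 ^ Suc j}"
    by (rule rz_pgrid) simp_all
qed (simp add: divide_strict_right_mono)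

text \<open>The answers along the grid depend on the oracle and need not be monotone in
  \<open>i\<close>. The first answer for the upper half, at \<open>n\<close>, bounds the cut from
  above by \<open>(n + 1) / 2^(j + 1)\<close>, and the answer before it bounds the cut from below by
  \<open>(n - 1) / 2^(j + 1)\<close>. So \<open>n / 2^(j + 1)\<close> is off by at most
  \<open>1 / 2^(j + 1)\<close>.\<close>

lemma papprox:
  assumes t: "rz t e (I c c')" and \<alpha>: "\<alpha> \<in> par T"
  shows "\<exists>g. eval \<alpha> (papprox t) [j \<triangleright> e] = Some g \<and> \<bar>cut_val c - of_rat (q g)\<bar> < 1 / 2 ^ j"
proof -
  note val = I_val[OF rz_nonempty[OF t]]
  let ?R = "pgrid_cell t"
  have "\<forall>i. \<exists>d. eval \<alpha> (pfst ?R) [i \<triangleright> j \<triangleright> e] = Some d \<and>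
      (d = comb_true T \<and> of_nat i / 2 ^ Suc j < cut_val c \<or>
       d = comb_false T \<and> cut_val c < of_nat (Suc i) / 2 ^ Suc j)"
  proof
    fix i
    let ?L = "fst c (of_nat i / 2 ^ Suc j)" and ?U = "snd c (of_nat (Suc i) / 2 ^ Suc j)"
    obtain b where b: "eval \<alpha> ?R [i \<triangleright> j \<triangleright> e] = Some b" "b \<in> ror T ?L ?U"
      using rz_grid_cell[OF t] \<alpha> unfolding rz_def by blast
    then have "\<phi> \<alpha> b (comb_true T) = Some (comb_true T) \<and> ?L \<noteq> {} \<or>
       \<phi> \<alpha> b (comb_true T) = Some (comb_false T) \<and> ?U \<noteq> {}"
      using \<alpha> unfolding ror_def app_in_def app_eq by blast
    then show "\<exists>d. eval \<alpha> (pfst ?R) [i \<triangleright> j \<triangleright> e] = Some d \<and>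
      (d = comb_true T \<and> of_nat i / 2 ^ Suc j < cut_val c \<or>
       d = comb_false T \<and> cut_val c < of_nat (Suc i) / 2 ^ Suc j)"
      using b(1) unfolding val by (auto simp: pfst_def of_rat_divide of_rat_power of_rat_mult of_rat_add)
  qed
  from choice[OF this] obtain d where d: "\<And>i. eval \<alpha> (pfst ?R) [i \<triangleright> j \<triangleright> e] = Some (d i)"
    and cases: "\<And>i. d i = comb_true T \<and> of_nat i / 2 ^ Suc j < cut_val c \<or>
       d i = comb_false T \<and> cut_val c < of_nat (Suc i) / 2 ^ Suc j" by blast
  let ?F = "\<lambda>i. (comb_false T - d i) + (d i - comb_false T)"
  have F: "?F i = 0 \<longleftrightarrow> d i = comb_false T" for i by auto
  have "d (2 ^ Suc j) = comb_false T"
    using cases[of "2 ^ Suc j"] val(1) by auto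
  then have "?F (2 ^ Suc j) = 0" by simp
  moreover have "eval \<alpha> (Comp diff_prog [pfst ?R, const_prog (comb_false T)]) [i \<triangleright> j \<triangleright> e] = Some (?F i)" for i
    by (simp add: d)
  ultimately obtain n where
    n: "eval \<alpha> (psearch (Comp diff_prog [pfst ?R, const_prog (comb_false T)])) [j \<triangleright> e] = Some n"
      "?F n = 0" "\<forall>m<n. ?F m \<noteq> 0"
    using eval_psearch_total[of \<alpha> "Comp diff_prog [pfst ?R, const_prog (comb_false T)]" "j \<triangleright> e" ?F "2 ^ Suc j"]
    by metis
  have up: "cut_val c < of_nat n / 2 ^ Suc j + 1 / 2 ^ Suc j"
    using cases[of n] n(2) true_neq_false unfolding F by (auto simp: add_divide_distrib)
  have down: "of_nat n / 2 ^ Suc j - 1 / 2 ^ Suc j \<le> cut_val c"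
  proof (cases n)
    \<comment> \<open>There is no previous answer; nonnegativity of the cut replaces it.\<close>
    case 0
    then show ?thesis using val(1) by (simp add: order_trans[of _ 0])
  next
    case (Suc m)
    then have "d m \<noteq> comb_false T" using n(3) unfolding F by blast
    with cases[of m] show ?thesis by (auto simp: Suc add_divide_distrib)
  qed
  obtain g where g: "eval \<alpha> (pgrid (pvar 0) (pvar 1)) [n \<triangleright> j \<triangleright> e] = Some g" "q g = of_nat n / 2 ^ Suc j"
    by (rule eval_pgrid[of \<alpha> "pvar 0" "n \<triangleright> j \<triangleright> e" n "pvar 1" j]) simp_all
  have "of_rat (q g) = (of_nat n / 2 ^ Suc j :: real)"
    unfolding g by (simp add: of_rat_divide of_rat_power of_rat_mult)
  moreover have "(1 :: real) / 2 ^ Suc j < 1 / 2 ^ j" by (simp add: field_simps)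
  ultimately have "\<bar>cut_val c - of_rat (q g)\<bar> < 1 / 2 ^ j"
    using up down by (simp only: abs_less_iff) linarith
  with g(1) n(1) show ?thesis by (simp add: papprox_def)
qed

text \<open>The Miller property enters through \<open>mu_clo\<close>: the approximations vary with
  the oracle, but the code of the closure that computes them is fixed.\<close>

lemma rz_index:
  assumes "rz t e (I c c')"
  shows "rz (plam (papprox t)) e (J (cut_val c))"
proof -
  have "\<mu> (clo (papprox t) e) = cut_val c"
    using papprox[OF assms] I_val(1)[OF rz_nonempty[OF assms]] by (intro mu_clo)
  then show ?thesis by (simp add: rz_def J_def)
qed

lemma I_mem:
  assumes "rz t e (I c c')"
  shows "b \<in> fst c r \<Longrightarrow> of_rat r < cut_val c" "b \<in> snd c r \<Longrightarrow> cut_val c < of_rat r"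
  using I_val(3,4)[OF rz_nonempty[OF assms], of r] by blast+

lemma I_empty:
  assumes "rz t e (I c c')"
  shows "of_rat r < cut_val c \<Longrightarrow> snd c r = {}" "cut_val c < of_rat r \<Longrightarrow> fst c r = {}"
  using I_val(3,4)[OF rz_nonempty[OF assms], of r] by fastforce+

lemma rz_rat_here: "rz fst_prog (k \<triangleright> e) {j. q j = q k}"
  by (rule rz_here) simp

text \<open>To realize \<open>fst c r\<close> from \<open>r < cut_val c\<close>,
  \<open>rz_below\<close> supplies a rational in between, and locatedness of \<open>c\<close> at
  these two rationals cannot answer with the upper half, which is uninhabited there. The other half
  is symmetric.\<close>

lemma K_if_I_left:
  "\<exists>f. \<forall>c c' t e. rz t e (I c c') \<longrightarrow> rz (f t) e (K c (cut_val c))"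
  apply (rule exI, intro allI impI)
  unfolding K_def riff_def
  apply (rule rz_pair)
   apply (rule rz_index, assumption)
  apply (rule rz_pair)
   apply (rule rz_allI, rule rz_pair)
    apply (rule rz_impI)
    apply (rule rz_mono, rule rz_strict_lower[OF rz_weak rz_here], assumption, assumption)
    apply (simp add: lower_def rat_obj_def I_mem)
   apply (rule rz_impI)
   apply (rule rz_let)
    apply (rule rz_below[OF rz_here rz_weak[OF rz_index]])
      apply (simp add: lower_def)
     apply assumption
    apply (simp add: lower_def)
   apply (rule rz_or_left)
    apply (rule rz_located)
       apply (rule rz_weak[OF rz_weak], assumption)
      apply (rule rz_weak[OF rz_here], simp add: lower_def)
     apply (rule rz_rat_here)
    apply simp
   apply (rule I_empty, assumption, simp)
  apply (rule rz_allI, rule rz_pair)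
   apply (rule rz_impI)
   apply (rule rz_mono, rule rz_strict_upper[OF rz_weak rz_here], assumption, assumption)
   apply (simp add: upper_def rat_obj_def I_mem)
  apply (rule rz_impI)
  apply (rule rz_let)
   apply (rule rz_above[OF rz_here rz_weak[OF rz_index]])
     apply (simp add: upper_def)
    apply assumption
   apply (simp add: upper_def)
  apply (rule rz_or_right)
   apply (rule rz_located)
      apply (rule rz_weak[OF rz_weak], assumption)
     apply (rule rz_rat_here)
    apply (rule rz_weak[OF rz_here], simp add: upper_def)
   apply simp
  apply (rule I_empty, assumption, simp)
  done

lemma K_if_I_right:
  "\<exists>f. \<forall>c c' t e. rz t e (I c c') \<longrightarrow> rz (f t) e (K c' (cut_val c))"
proof -
  note left = K_if_I_left[THEN someI_ex, rule_format]
  note eqL = rz_equal_lower[unfolded riff_def]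
  note eqU = rz_equal_upper[unfolded riff_def]
  show ?thesis
    apply (rule exI, intro allI impI)
    unfolding K_def riff_def
    apply (rule rz_pair)
     apply (rule rz_index, assumption)
    apply (rule rz_pair)
     apply (rule rz_allI, rule rz_pair)
      apply (rule rz_impI)
      apply (rule K_lowerD[OF rz_weak[OF left]], assumption)
      apply (rule rz_impE[OF rz_snd[OF eqL[OF rz_weak]] rz_here], assumption, assumption)
     apply (rule rz_impI)
     apply (rule rz_impE[OF rz_fst[OF eqL[OF rz_weak]]], assumption)
     apply (rule K_lowerI[OF rz_weak[OF left] rz_here], assumption, assumption)
    apply (rule rz_allI, rule rz_pair)
     apply (rule rz_impI)
     apply (rule K_upperD[OF rz_weak[OF left]], assumption)
     apply (rule rz_impE[OF rz_snd[OF eqU[OF rz_weak]] rz_here], assumption, assumption)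
    apply (rule rz_impI)
    apply (rule rz_impE[OF rz_fst[OF eqU[OF rz_weak]]], assumption)
    apply (rule K_upperI[OF rz_weak[OF left] rz_here], assumption, assumption)
    done
qed

text \<open>\<open>I c c'\<close> contains the cut conditions for \<open>c\<close> only; those for
  \<open>c'\<close> are rebuilt from \<open>K c' (cut_val c)\<close>.\<close>

lemma I_right_exists:
  "\<exists>f. \<forall>c c' t e. rz t e (I c c') \<longrightarrow> rz (f t) e (I c' c')"
proof -
  note right = K_if_I_right[THEN someI_ex, rule_format]
  note I = I_if_K[THEN someI_ex, rule_format]
  show ?thesis
    apply (rule exI, intro allI impI)
    apply (rule I)
      apply (rule I_val, erule rz_nonempty)
     apply (rule right, assumption)
    apply (rule right, assumption)
    done
qed

text \<open>Both points are exchanged for evidence about the same canonical cut. Together with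
  \<open>rz_index\<close> and \<open>I_mk_cut\<close> this presents the interval as a quotient of
  the codes.\<close>

lemma I_equal_if_val:
  "\<exists>f. \<forall>c c' t u e. rz t e (I c c) \<longrightarrow> rz u e (I c' c') \<longrightarrow> cut_val c = cut_val c' \<longrightarrow>
     rz (f t u) e (I c c')"
proof -
  note left = K_if_I_left[THEN someI_ex, rule_format]
  note I = I_if_K[THEN someI_ex, rule_format]
  show ?thesis
    apply (rule exI, intro allI impI)
    apply (rule I)
      apply (rule I_val, erule rz_nonempty)
     apply (rule left, assumption)
    apply simp
    apply (rule left, assumption)
    done
qed

definition mk_cut :: "real \<Rightarrow> (rat \<Rightarrow> nat set) \<times> (rat \<Rightarrow> nat set)" where
  "mk_cut x = (lower x, upper x)"

lemma cut_val_mk_cut: "cut_val (mk_cut x) = x"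
  using q_surj by (intro cut_val_canonical) (auto simp: mk_cut_def lower_def)

lemma J_bounds: "rz t e (J x) \<Longrightarrow> x \<in> {0..1}"
  using rz_nonempty[of t e "J x"] mu_bounds by (auto simp: J_def)

lemma I_mk_cut:
  "\<exists>f. \<forall>x t e. rz t e (J x) \<longrightarrow> rz (f t) e (I (mk_cut x) (mk_cut x))"
proof -
  have "\<exists>f. \<forall>x t e. rz t e (J x) \<longrightarrow> rz (f t) e (K (mk_cut x) x)"
    apply (rule exI, intro allI impI)
    unfolding K_def riff_def mk_cut_def fst_conv snd_conv
    apply (rule rz_pair, assumption)
    apply (rule rz_pair)
     apply (rule rz_allI, rule rz_pair)
      apply (rule rz_impI[OF rz_here], assumption)
     apply (rule rz_impI[OF rz_here], assumption)
    apply (rule rz_allI, rule rz_pair)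
     apply (rule rz_impI[OF rz_here], assumption)
    apply (rule rz_impI[OF rz_here], assumption)
    done
  note K = this[THEN someI_ex, rule_format]
  note I = I_if_K[THEN someI_ex, rule_format]
  show ?thesis
    apply (rule exI, intro allI impI)
    apply (rule I)
      apply (erule J_bounds)
     apply (rule K, assumption)
    apply (rule K, assumption)
    done
qed

end

section \<open>Functional relations and the diagonal argument\<close>

context oracle_ppca begin

definition pstrict :: "prog \<Rightarrow> prog \<Rightarrow> prog" where
  "pstrict t u = papp (pspec (pfst (pfst (pfst t)))) u"

definition pext :: "prog \<Rightarrow> prog \<Rightarrow> prog \<Rightarrow> prog \<Rightarrow> prog" where
  "pext t u v w = papp (pspec (pspec (psnd (pfst (pfst t))))) (ppair u (ppair v w))"

definition ptotal :: "prog \<Rightarrow> prog \<Rightarrow> prog" where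
  "ptotal t u = papp (pspec (psnd (psnd t))) u"

lemma exp_obj_eq: "exp_obj T X Y F G =
  rand T (rand T (rand T
      (rall T (\<lambda>z. rimp T (F z) (prod_obj T X Y z z)))
      (rall T (\<lambda>z. rall T (\<lambda>z'. rimp T (rand T (F z) (prod_obj T X Y z z')) (F z')))))
    (rall T (\<lambda>z. riff T (F z) (G z))))
   (rand T
     (all_in T X (\<lambda>x. all_in T Y (\<lambda>y. all_in T Y (\<lambda>y'.
          rimp T (rand T (F (x, y)) (F (x, y'))) (Y y y')))))
     (all_in T X (\<lambda>x. ex_in T Y (\<lambda>y. F (x, y)))))"
  by (simp add: exp_obj_def sub_obj_def pow_obj_def strict_extensional_def single_valued_total_def)

lemma rz_exp_strict:
  assumes "rz t e (exp_obj T X Y F G)" "rz u e (F (x, y))"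
  shows "rz (pstrict t u) e (rand T (X x x) (Y y y))"
proof -
  have "rz (pfst (pfst (pfst t))) e (rall T (\<lambda>z. rimp T (F z) (prod_obj T X Y z z)))"
    using assms(1) unfolding exp_obj_eq by (intro rz_fst) assumption
  from rz_impE[OF rz_allE[OF this, of "(x, y)"] assms(2)] show ?thesis
    by (simp add: prod_obj_def pstrict_def)
qed

lemma rz_exp_ext:
  assumes "rz t e (exp_obj T X Y F G)" "rz u e (F (x, y))" "rz v e (X x x')" "rz w e (Y y y')"
  shows "rz (pext t u v w) e (F (x', y'))"
proof -
  have "rz (psnd (pfst (pfst t))) e
      (rall T (\<lambda>z. rall T (\<lambda>z'. rimp T (rand T (F z) (prod_obj T X Y z z')) (F z'))))"
    using assms(1) unfolding exp_obj_eq by (intro rz_fst rz_snd) assumption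
  from rz_allE[OF rz_allE[OF this, of "(x, y)"], of "(x', y')"]
  have *: "rz (pspec (pspec (psnd (pfst (pfst t))))) e
      (rimp T (rand T (F (x, y)) (prod_obj T X Y (x, y) (x', y'))) (F (x', y')))" .
  have "rz (ppair u (ppair v w)) e (rand T (F (x, y)) (prod_obj T X Y (x, y) (x', y')))"
    unfolding prod_obj_def prod.case by (intro rz_pair assms)
  from rz_impE[OF * this] show ?thesis by (simp add: pext_def)
qed

lemma rz_exp_total:
  assumes "rz t e (exp_obj T X Y F G)" "rz u e (X x x)"
  shows "rz (ptotal t u) e (ex_in T Y (\<lambda>y. F (x, y)))"
proof -
  have "rz (psnd (psnd t)) e (all_in T X (\<lambda>x. ex_in T Y (\<lambda>y. F (x, y))))"
    using assms(1) unfolding exp_obj_eq by (intro rz_snd) assumption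
  from rz_all_inE[OF this assms(2)] show ?thesis by (simp add: ptotal_def)
qed

text \<open>The second argument of \<open>exp_obj\<close> occurs only in the pointwise equivalence;
  all other components concern \<open>F\<close> and are copied.\<close>

lemma rz_exp_change:
  assumes "rz t e (exp_obj T X Y F F')" "\<And>z. rz u e (riff T (F z) (G z))"
  shows "rz (ppair (ppair (pfst (pfst t)) (pgen u)) (psnd t)) e (exp_obj T X Y F G)"
  using assms(1) unfolding exp_obj_eq
  by (intro rz_pair rz_allI assms(2)) (erule rz_fst[OF rz_fst], erule rz_snd)

lemma rz_all_pairI:
  assumes "\<And>x y. rz t e (\<psi> (x, y))"
  shows "rz (pgen t) e (rall T \<psi>)"
  by (rule rz_allI) (metis assms surj_pair)

lemma exp_strict_nonempty:
  assumes "exp_obj T X Y F G \<noteq> {}" "F (x, y) \<noteq> {}"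
  shows "X x x \<noteq> {}" "Y y y \<noteq> {}"
proof -
  obtain a b where "a \<in> exp_obj T X Y F G" "b \<in> F (x, y)" using assms by blast
  from rz_exp_strict[OF rz_const[OF this(1)] rz_const[OF this(2)]]
  have "rand T (X x x) (Y y y) \<noteq> {}" by (rule rz_nonempty)
  then show "X x x \<noteq> {}" "Y y y \<noteq> {}" unfolding rand_nonempty by simp_all
qed

lemma exp_single_valued:
  assumes F: "exp_obj T X Y F G \<noteq> {}" and y: "F (x, y) \<noteq> {}" and y': "F (x, y') \<noteq> {}"
  shows "Y y y' \<noteq> {}"
proof -
  have "all_in T X (\<lambda>x. all_in T Y (\<lambda>y. all_in T Y (\<lambda>y'.
          rimp T (rand T (F (x, y)) (F (x, y'))) (Y y y')))) \<noteq> {}"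
    using F unfolding exp_obj_eq rand_nonempty by blast
  from all_in_nonempty[OF this exp_strict_nonempty(1)[OF F y]]
  have "all_in T Y (\<lambda>y. all_in T Y (\<lambda>y'.
          rimp T (rand T (F (x, y)) (F (x, y'))) (Y y y'))) \<noteq> {}" .
  from all_in_nonempty[OF this exp_strict_nonempty(2)[OF F y]]
  have "all_in T Y (\<lambda>y'. rimp T (rand T (F (x, y)) (F (x, y'))) (Y y y')) \<noteq> {}" .
  from all_in_nonempty[OF this exp_strict_nonempty(2)[OF F y']]
  have "rimp T (rand T (F (x, y)) (F (x, y'))) (Y y y') \<noteq> {}" .
  moreover have "rand T (F (x, y)) (F (x, y')) \<noteq> {}"
    unfolding rand_nonempty using y y' by simp
  ultimately show ?thesis by (rule rimp_nonempty)
qed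

section \<open>Fixed points from a diagonal property of codes\<close>

definition fun_val :: "('y \<Rightarrow> 'v) \<Rightarrow> ('x \<times> 'y \<Rightarrow> nat set) \<Rightarrow> 'x \<Rightarrow> 'v" where
  "fun_val val F x = (THE v. \<exists>y. F (x, y) \<noteq> {} \<and> val y = v)"

lemma fun_val_eq:
  assumes "exp_obj T X Y F G \<noteq> {}" "F (x, y) \<noteq> {}"
    and "\<And>y y'. Y y y' \<noteq> {} \<Longrightarrow> val y = val y'"
  shows "fun_val val F x = val y"
  unfolding fun_val_def using assms exp_single_valued[OF assms(1)] by blast

text \<open>Realizers of a multivalued map on codes: the result at \<open>n\<close> may depend on
  the oracle as long as it stays in \<open>S n\<close>.\<close>

definition total_into :: "(nat \<Rightarrow> nat set) \<Rightarrow> nat set" where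
  "total_into S = {c. \<forall>n. \<forall>p\<in>par T. app_in T p c n (S n)}"

lemma rz_total_into:
  assumes "\<And>n. rz t (n \<triangleright> e) (S n)"
  shows "rz (plam t) e (total_into S)"
  using assms by (simp add: rz_def total_into_def app_in_def app_eq)

text \<open>The index \<open>i\<close> ranges over a family for which one program must do;
  \<open>\<nu> i n\<close> is the value coded by \<open>n\<close>, and \<open>pt i n\<close> a point
  with this value. Totality of a map \<open>F\<close> at \<open>pt i n\<close>, followed by
  \<open>code\<close>, computes codes of the value of \<open>F\<close> there, so \<open>diag\<close>
  yields an \<open>n\<close> for which that value is \<open>\<nu> i n\<close>.\<close>

lemma lawvere_fixed_point:
  fixes Z :: "'i \<Rightarrow> (nat, 'z) tobj" and val :: "'i \<Rightarrow> 'z \<Rightarrow> 'v"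
  assumes val: "\<And>i z z'. A i \<Longrightarrow> Z i z z' \<noteq> {} \<Longrightarrow> val i z = val i z'"
    and val_pt: "\<And>i n. A i \<Longrightarrow> val i (pt i n) = \<nu> i n"
    and equal: "\<exists>f. \<forall>i z z' t u e. A i \<longrightarrow> rz t e (Z i z z) \<longrightarrow> rz u e (Z i z' z') \<longrightarrow>
      val i z = val i z' \<longrightarrow> rz (f t u) e (Z i z z')"
    and code: "\<exists>f. \<forall>i z t e. A i \<longrightarrow> rz t e (Z i z z) \<longrightarrow> rz (f t) e {n. \<nu> i n = val i z}"
    and pt: "\<exists>f. \<forall>i n t e. A i \<longrightarrow> rz t e {n} \<longrightarrow> rz (f t) e (Z i (pt i n) (pt i n))"
    and diag: "\<exists>f. \<forall>i g t e. A i \<longrightarrow> rz t e (total_into (\<lambda>n. {m. \<nu> i m = g n})) \<longrightarrow>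
      rz (f t) e {n. \<nu> i n = g n}"
  shows "\<exists>t. \<forall>i e. A i \<longrightarrow> rz t e (every_map_has_fixed_point T (Z i))"
proof -
  note equal' = equal[THEN someI_ex, rule_format]
  note code' = code[THEN someI_ex, rule_format]
  note pt' = pt[THEN someI_ex, rule_format]
  note diag' = diag[THEN someI_ex, rule_format]
  have fv: "fun_val (val i) F (pt i n) = val i z"
    if "A i" "b \<in> exp_obj T (Z i) (Z i) F F" "y \<in> rand T (Z i z z) (F (pt i n, z))" for i F b n y z
    using that rand_memD[OF that(3)] val by (intro fun_val_eq[of "Z i" "Z i" F F]) blast+
  have "\<exists>f. \<forall>i F b e. A i \<longrightarrow> b \<in> exp_obj T (Z i) (Z i) F F \<longrightarrow>
      rz f (b \<triangleright> e) {n. \<nu> i n = fun_val (val i) F (pt i n)}"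
    apply (rule exI, intro allI impI)
    apply (rule diag', assumption)
    apply (rule rz_total_into)
    apply (rule rz_ex_inE)
     apply (rule rz_exp_total[OF rz_weak[OF rz_here]], assumption)
     apply (rule pt', assumption)
     apply (rule rz_here, rule singletonI)
    apply (subst fv, assumption, assumption, assumption)
    apply (rule code', assumption)
    apply (rule rz_fst[OF rz_here], assumption)
    done
  note fixpt = this[THEN someI_ex, rule_format]
  show ?thesis
    apply (rule exI, intro allI impI)
    unfolding every_map_has_fixed_point_def
    apply (rule rz_all_inI)
    apply (rule rz_let)
     apply (rule fixpt, assumption, assumption)
    apply (rule rz_ex_inE)
     apply (rule rz_exp_total[OF rz_weak[OF rz_here]], assumption)
     apply (rule pt', assumption)
     apply (rule rz_here, rule singletonI)
    apply (rule rz_ex_inI)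
     apply (rule pt', assumption)
     apply (rule rz_weak[OF rz_here], rule singletonI)
    \<comment> \<open>Here \<open>F\<close> relates \<open>pt i n\<close> to some \<open>z\<close>
      with the same value as \<open>pt i n\<close>; so \<open>z\<close> equals \<open>pt i n\<close>
      by \<open>equal\<close>, and extensionality of \<open>F\<close> replaces \<open>z\<close> by
      it.\<close>
    apply (rule rz_exp_ext)
       apply (rule rz_weak[OF rz_weak[OF rz_here]], assumption)
      apply (rule rz_snd[OF rz_here], assumption)
     apply (rule pt', assumption)
     apply (rule rz_weak[OF rz_here], rule singletonI)
    apply (rule equal', assumption)
      apply (rule rz_fst[OF rz_here], assumption)
     apply (rule pt', assumption)
     apply (rule rz_weak[OF rz_here], rule singletonI)
    apply (simp add: val_pt)
    apply (rule fv[symmetric], assumption, assumption, assumption)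
    done
qed

end

section \<open>Sequences in the interval and their codes\<close>

context miller begin

text \<open>
  Covers \<^const>\<open>nat_obj\<close> and all \<^const>\<open>below_obj\<close> with realizers that do not depend on the object.
\<close>

definition tracked :: "(prog \<Rightarrow> prog) \<Rightarrow> (prog \<Rightarrow> prog) \<Rightarrow> (nat, nat) tobj \<Rightarrow> bool" where
  "tracked dec enc D \<longleftrightarrow>
     (\<forall>k k'. D k k' \<noteq> {} \<longrightarrow> k = k') \<and>
     (\<forall>k t e. rz t e (D k k) \<longrightarrow> rz (dec t) e {k}) \<and>
     (\<forall>k t e. D k k \<noteq> {} \<longrightarrow> rz t e {k} \<longrightarrow> rz (enc t) e (D k k))"

lemma tracked_eq: "tracked dec enc D \<Longrightarrow> D k k' \<noteq> {} \<Longrightarrow> k = k'"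
  unfolding tracked_def by blast

lemma tracked_dec: "tracked dec enc D \<Longrightarrow> rz t e (D k k) \<Longrightarrow> rz (dec t) e {k}"
  unfolding tracked_def by blast

lemma tracked_enc: "tracked dec enc D \<Longrightarrow> D k k \<noteq> {} \<Longrightarrow> rz t e {k} \<Longrightarrow> rz (enc t) e (D k k)"
  unfolding tracked_def by blast

text \<open>The default 0 outside the domain is shared with \<open>slices\<close>, so that equality
  of such functions amounts to equality on the domain.\<close>

definition seq_val :: "(nat, nat) tobj \<Rightarrow> (nat \<times> ((rat \<Rightarrow> nat set) \<times> (rat \<Rightarrow> nat set)) \<Rightarrow> nat set) \<Rightarrow>
    nat \<Rightarrow> real" where
  "seq_val D G k = (if D k k = {} then 0 else fun_val cut_val G k)"

definition slices :: "(nat, nat) tobj \<Rightarrow> nat \<Rightarrow> nat \<Rightarrow> real" where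
  "slices D n k = (if D k k = {} then 0 else \<mu> (slice n k))"

definition mk_seq :: "(nat, nat) tobj \<Rightarrow> nat \<Rightarrow>
    nat \<times> ((rat \<Rightarrow> nat set) \<times> (rat \<Rightarrow> nat set)) \<Rightarrow> nat set" where
  "mk_seq D n = (\<lambda>(k, c). {b \<in> rand T (D k k) (I c c). cut_val c = \<mu> (slice n k)})"

text \<open>For \<open>?n = clo (plam t) e\<close>, applying \<open>?n\<close> to itself gives the
  closure of \<open>t\<close> over \<open>?n \<triangleright> e\<close>, so \<open>t\<close> can
  read the code that is being defined. The self-application inside \<open>slice\<close> thus takes
  the place of a recursion theorem.\<close>

lemma rz_slices:
  assumes "\<And>n k. P k \<Longrightarrow> rz t (k \<triangleright> n \<triangleright> e) (J (g n k))"
  shows "rz (plam (plam t)) e {n. \<forall>k. P k \<longrightarrow> \<mu> (slice n k) = g n k}"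
proof -
  let ?n = "clo (plam t) e"
  have "\<mu> (slice ?n k) = g ?n k" if "P k" for k
    using assms[OF that, of ?n] by (intro mu_slice) (auto simp: rz_def J_def)
  then show ?thesis by (simp add: rz_def)
qed

lemma slices_diagonal:
  "\<exists>f. \<forall>D g t e. rz t e (total_into (\<lambda>n. {m. slices D m = g n})) \<longrightarrow>
     rz (f t) e {n. slices D n = g n}"
proof (intro exI allI impI)
  fix D t e and g :: "nat \<Rightarrow> nat \<Rightarrow> real"
  assume t: "rz t e (total_into (\<lambda>n. {m. slices D m = g n}))"
  \<comment> \<open>In the environment
    \<open>k \<triangleright> n \<triangleright> c \<triangleright> e\<close> this runs
    \<open>c\<close> on \<open>n\<close> and returns the code of the \<open>k\<close>-th slice of
    the result. When \<open>n\<close> is the code of this very program, its own \<open>k\<close>-th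
    value becomes \<open>g n k\<close>.\<close>
  let ?t = "pslice (papp (pvar 2) (pvar 1)) (pvar 0)"
  show "rz (plet t (plam (plam ?t))) e {n. slices D n = g n}"
    using t
  proof (rule rz_let)
    fix c assume c: "c \<in> total_into (\<lambda>n. {m. slices D m = g n})"
    have "rz (plam (plam ?t)) (c \<triangleright> e) {n. \<forall>k. D k k \<noteq> {} \<longrightarrow> \<mu> (slice n k) = g n k}"
    proof (rule rz_slices)
      fix n k assume k: "D k k \<noteq> {}"
      show "rz ?t (k \<triangleright> n \<triangleright> c \<triangleright> e) (J (g n k))"
        unfolding rz_def
      proof
        fix \<alpha> assume "\<alpha> \<in> par T"
        then obtain m where m: "\<phi> \<alpha> c n = Some m" "slices D m = g n"
          using c unfolding total_into_def app_in_def app_eq by blast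
        have "\<mu> (slice m k) = g n k" using k by (simp add: m(2)[symmetric] slices_def)
        with m(1) show "\<exists>b. eval \<alpha> ?t [k \<triangleright> n \<triangleright> c \<triangleright> e] = Some b \<and> b \<in> J (g n k)"
          by (simp add: J_def numeral_2_eq_2)
      qed
    qed
    \<comment> \<open>Under any one parameter, \<open>c\<close> produces an \<open>m\<close> with
      \<open>slices D m = g n\<close>, so \<open>g n\<close> inherits the default value.\<close>
    moreover have "g n k = 0" if "D k k = {}" for n k
    proof -
      obtain m where m: "slices D m = g n"
        using c par_nonempty unfolding total_into_def app_in_def by blast
      show ?thesis using that by (simp add: m[symmetric] slices_def)
    qed
    ultimately show "rz (plam (plam ?t)) (c \<triangleright> e) {n. slices D n = g n}"
      by (elim rz_mono) (auto simp: slices_def fun_eq_iff)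
  qed
qed

lemma seq_val_eq:
  assumes "exp_obj T D I G G' \<noteq> {}" "G (k, c) \<noteq> {}"
  shows "seq_val D G k = cut_val c"
  unfolding seq_val_def using assms exp_strict_nonempty(1)[OF assms]
  by (simp add: fun_val_eq[OF assms] I_val(2))

lemma seq_val_equal:
  assumes "exp_obj T D I G G' \<noteq> {}"
  shows "seq_val D G = seq_val D G'"
proof -
  have "rall T (\<lambda>z. riff T (G z) (G' z)) \<noteq> {}"
    using assms unfolding exp_obj_eq rand_nonempty by blast
  then have "G z \<noteq> {} \<longleftrightarrow> G' z \<noteq> {}" for z by (rule rall_riff_nonempty)
  then show ?thesis unfolding seq_val_def fun_val_def by presburger
qed

lemma seq_val_mem:
  assumes "rz t e (exp_obj T D I G G')" "b \<in> rand T (I c c) (G (k, c))"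
  shows "seq_val D G k = cut_val c"
  using rand_memD[OF assms(2)] by (intro seq_val_eq[OF rz_nonempty[OF assms(1)]]) blast

text \<open>The program given to \<open>rz_slices\<close> evaluates \<open>G\<close> at
  \<open>k\<close> and takes the index of the resulting cut; it makes no use of its own
  code.\<close>

lemma seq_code:
  "\<exists>f. \<forall>D G t e. tracked dec enc D \<longrightarrow> rz t e (exp_obj T D I G G) \<longrightarrow>
     rz (f t) e {n. slices D n = seq_val D G}"
proof -
  have sub: "{n. \<forall>k. D k k \<noteq> {} \<longrightarrow> \<mu> (slice n k) = seq_val D G k} \<subseteq> {n. slices D n = seq_val D G}"
    for D G by (auto simp: slices_def seq_val_def fun_eq_iff)
  show ?thesis
    apply (rule exI, intro allI impI)
    apply (rule rz_mono[OF _ sub])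
    apply (rule rz_slices)
    apply (rule rz_ex_inE)
     apply (rule rz_exp_total)
      apply (rule rz_weak[OF rz_weak], assumption)
      apply (rule tracked_enc, assumption, assumption)
     apply (rule rz_here, rule singletonI)
    apply (subst seq_val_mem, assumption, assumption)
    apply (rule rz_index[OF rz_fst[OF rz_here]], assumption)
    done
qed

text \<open>Totality of \<open>G'\<close> at \<open>k\<close> provides some \<open>c'\<close> with
  the same value as \<open>c\<close>. Hence \<open>c'\<close> equals \<open>c\<close> in the
  interval, and extensionality moves \<open>G' (k, c')\<close> to \<open>G' (k, c)\<close>.\<close>

lemma seq_equal_half:
  "\<exists>f. \<forall>D G G' t u e k c. tracked dec enc D \<longrightarrow> rz u e (exp_obj T D I G' G') \<longrightarrow>
     rz t e (exp_obj T D I G G) \<longrightarrow> seq_val D G = seq_val D G' \<longrightarrow>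
     rz (f t u) e (rimp T (G (k, c)) (G' (k, c)))"
proof -
  note equal = I_equal_if_val[THEN someI_ex, rule_format]
  have val: "cut_val c' = cut_val c" if "rz t e (exp_obj T D I G G)" "rz u e (exp_obj T D I G' G')"
    "seq_val D G = seq_val D G'" "b \<in> G (k, c)" "b' \<in> rand T (I c' c') (G' (k, c'))"
    for D G G' t u e k c c' b b'
    using seq_val_mem[OF that(2,5)] seq_val_eq[OF rz_nonempty[OF that(1)], of k c] that(3,4) by auto
  show ?thesis
    apply (rule exI, intro allI impI)
    apply (rule rz_impI)
    apply (rule rz_let)
     apply (rule rz_exp_strict[OF rz_weak rz_here], assumption, assumption)
    apply (rule rz_ex_inE)
     apply (rule rz_exp_total[OF rz_weak[OF rz_weak]], assumption)
     apply (rule rz_fst[OF rz_here], assumption)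
    apply (rule rz_exp_ext)
       apply (rule rz_weak[OF rz_weak[OF rz_weak]], assumption)
      apply (rule rz_snd[OF rz_here], assumption)
     apply (rule rz_weak[OF rz_fst[OF rz_here]], assumption)
    apply (rule equal)
      apply (rule rz_fst[OF rz_here], assumption)
     apply (rule rz_weak[OF rz_snd[OF rz_here]], assumption)
    apply (rule val, assumption, assumption, assumption, assumption, assumption)
    done
qed

lemma seq_equal:
  "\<exists>f. \<forall>D G G' t u e. tracked dec enc D \<longrightarrow> rz t e (exp_obj T D I G G) \<longrightarrow>
     rz u e (exp_obj T D I G' G') \<longrightarrow> seq_val D G = seq_val D G' \<longrightarrow>
     rz (f t u) e (exp_obj T D I G G')"
proof -
  have "\<exists>f. \<forall>D G G' t u e z. tracked dec enc D \<longrightarrow> rz u e (exp_obj T D I G' G') \<longrightarrow>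
     rz t e (exp_obj T D I G G) \<longrightarrow> seq_val D G = seq_val D G' \<longrightarrow>
     rz (f t u) e (rimp T (G z) (G' z))"
    using seq_equal_half[of dec enc] by (simp only: split_paired_All)
  note half = this[THEN someI_ex, rule_format]
  show ?thesis
    apply (rule exI, intro allI impI)
    apply (rule rz_exp_change, assumption)
    unfolding riff_def
    apply (rule rz_pair)
     apply (rule half, assumption, assumption, assumption, assumption)
    apply (rule half, assumption, assumption, assumption, erule sym)
    done
qed

lemma mk_seq_sub: "mk_seq D n (k, c) \<subseteq> rand T (D k k) (I c c)"
  by (auto simp: mk_seq_def)

lemma mk_seq_val: "mk_seq D n (k, c) \<noteq> {} \<Longrightarrow> cut_val c = \<mu> (slice n k)"
  by (auto simp: mk_seq_def)

lemma rz_mk_seq: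
  "rz t e (rand T (D k k) (I c c)) \<Longrightarrow> cut_val c = \<mu> (slice n k) \<Longrightarrow> rz t e (mk_seq D n (k, c))"
  by (simp add: mk_seq_def)

lemma mk_seq_ext_mem:
  assumes "tracked dec enc D" "b \<in> rand T (mk_seq D n (k, c)) (rand T (D k k') (I c c'))"
  shows "D k k \<subseteq> D k' k'" "cut_val c' = \<mu> (slice n k')"
proof -
  have *: "mk_seq D n (k, c) \<noteq> {}" "D k k' \<noteq> {}" "I c c' \<noteq> {}"
    using rand_memD[OF assms(2)] unfolding rand_nonempty by blast+
  then have "k = k'" using tracked_eq[OF assms(1)] by blast
  with * show "D k k \<subseteq> D k' k'" "cut_val c' = \<mu> (slice n k')"
    using mk_seq_val I_val(2) by auto
qed

lemma rz_slice_J: "rz t e {n} \<Longrightarrow> rz u e {k} \<Longrightarrow> rz (pslice t u) e (J (\<mu> (slice n k)))"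
  by (auto simp: rz_def J_def)

text \<open>Single-valuedness is \<open>I_equal_if_val\<close>, since the value is prescribed at
  each \<open>k\<close>. For totality, \<open>slice n k\<close> itself codes the witness
  \<open>mk_cut (\<mu> (slice n k))\<close>.\<close>

lemma mk_seq_exists:
  "\<exists>f. \<forall>D n t e. tracked dec enc D \<longrightarrow> rz t e {n} \<longrightarrow>
     rz (f t) e (exp_obj T D I (mk_seq D n) (mk_seq D n))"
proof -
  note equal = I_equal_if_val[THEN someI_ex, rule_format]
  note right = I_right_exists[THEN someI_ex, rule_format]
  note mk = I_mk_cut[THEN someI_ex, rule_format]
  have val: "cut_val c = cut_val c'" if "b \<in> rand T (mk_seq D n (k, c)) (mk_seq D n (k, c'))"
    for b D n k c c'
    using rand_memD[OF that] mk_seq_val by metis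
  show ?thesis
    apply (rule exI, intro allI impI)
    unfolding exp_obj_eq riff_def prod_obj_def
    apply (rule rz_pair, rule rz_pair, rule rz_pair)
       apply (rule rz_all_pairI, rule rz_impI)
       apply (simp only: prod.case)
       apply (rule rz_mono[OF rz_here mk_seq_sub], assumption)
      apply (rule rz_all_pairI, rule rz_all_pairI, rule rz_impI)
      apply (simp only: prod.case)
      apply (rule rz_mk_seq)
       apply (rule rz_pair)
        apply (rule rz_mono)
         apply (rule rz_fst[OF rz_mono[OF rz_fst[OF rz_here] mk_seq_sub]], assumption)
        apply (rule mk_seq_ext_mem, assumption, assumption)
       apply (rule right)
       apply (rule rz_snd[OF rz_snd[OF rz_here]], assumption)
      apply (rule mk_seq_ext_mem, assumption, assumption)
     apply (rule rz_allI, rule rz_pair)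
      apply (rule rz_impI, rule rz_here, assumption)
     apply (rule rz_impI, rule rz_here, assumption)
    apply (rule rz_pair)
     apply (rule rz_all_inI, rule rz_all_inI, rule rz_all_inI, rule rz_impI)
     apply (rule equal)
       apply (rule rz_weak[OF rz_weak[OF rz_here]], assumption)
      apply (rule rz_weak[OF rz_here], assumption)
     apply (rule val, assumption)
    apply (rule rz_all_inI)
    apply (rule rz_ex_inI)
     apply (rule mk, rule rz_slice_J)
      apply (rule rz_weak, assumption)
     apply (rule tracked_dec, assumption)
     apply (rule rz_here, assumption)
    apply (rule rz_mk_seq)
     apply (rule rz_pair)
      apply (rule rz_here, assumption)
     apply (rule mk, rule rz_slice_J)
      apply (rule rz_weak, assumption)
     apply (rule tracked_dec, assumption)
     apply (rule rz_here, assumption)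
    apply (rule cut_val_mk_cut)
    done
qed

text \<open>The realizers obtained here serve only to show that the functional relation and the
  canonical cut are inhabited.\<close>

lemma seq_val_mk_seq:
  assumes "tracked dec enc D"
  shows "seq_val D (mk_seq D n) = slices D n"
proof
  fix k
  obtain f where f: "rz (f (const_prog n)) 0 (exp_obj T D I (mk_seq D n) (mk_seq D n))"
    using mk_seq_exists[of dec enc] assms rz_const[of n "{n}"] by blast
  obtain g where g: "rz (g (const_prog (slice n k))) 0
      (I (mk_cut (\<mu> (slice n k))) (mk_cut (\<mu> (slice n k))))"
    using I_mk_cut rz_const[of "slice n k" "J (\<mu> (slice n k))"] unfolding J_def by blast
  show "seq_val D (mk_seq D n) k = slices D n k"
  proof (cases "D k k = {}")
    case False
    have "mk_seq D n (k, mk_cut (\<mu> (slice n k))) =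
        rand T (D k k) (I (mk_cut (\<mu> (slice n k))) (mk_cut (\<mu> (slice n k))))"
      by (simp add: mk_seq_def cut_val_mk_cut)
    then have "mk_seq D n (k, mk_cut (\<mu> (slice n k))) \<noteq> {}"
      using False rz_nonempty[OF g] by (simp only: rand_nonempty) simp
    from seq_val_eq[OF rz_nonempty[OF f] this] False show ?thesis
      by (simp add: slices_def cut_val_mk_cut)
  qed (simp add: seq_val_def slices_def)
qed

text \<open>The index of the family in \<open>lawvere_fixed_point\<close> is the domain
  \<open>D\<close> itself, so the program depends on \<open>dec\<close> and \<open>enc\<close>
  alone.\<close>

lemma fixed_point_tracked:
  "\<exists>t. \<forall>D e. tracked dec enc D \<longrightarrow> rz t e (every_map_has_fixed_point T (exp_obj T D I))"
proof (rule lawvere_fixed_point[where val = seq_val and \<nu> = slices and pt = mk_seq])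
  show "\<exists>f. \<forall>D n t e. tracked dec enc D \<longrightarrow> rz t e {n} \<longrightarrow>
     rz (f t) e (exp_obj T D I (mk_seq D n) (mk_seq D n))" by (rule mk_seq_exists)
  show "\<exists>f. \<forall>D G t e. tracked dec enc D \<longrightarrow> rz t e (exp_obj T D I G G) \<longrightarrow>
     rz (f t) e {n. slices D n = seq_val D G}" by (rule seq_code)
  show "\<exists>f. \<forall>D G G' t u e. tracked dec enc D \<longrightarrow> rz t e (exp_obj T D I G G) \<longrightarrow>
     rz u e (exp_obj T D I G' G') \<longrightarrow> seq_val D G = seq_val D G' \<longrightarrow>
     rz (f t u) e (exp_obj T D I G G')" by (rule seq_equal)
  show "\<exists>f. \<forall>D g t e. tracked dec enc D \<longrightarrow> rz t e (total_into (\<lambda>n. {m. slices D m = g n})) \<longrightarrow>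
     rz (f t) e {n. slices D n = g n}" using slices_diagonal by blast
qed (erule seq_val_equal seq_val_mk_seq)+

lemma tracked_nat_obj: "tracked (\<lambda>t. t) (\<lambda>t. t) nat_obj"
  by (auto simp: tracked_def nat_obj_def)

text \<open>The bound \<open>k < n\<close> is realized by every number or by none, so 0 can be
  supplied for it, and decoding and encoding are the same for all \<open>n\<close>.\<close>

lemma tracked_below_obj: "tracked pfst (\<lambda>t. ppair t (const_prog 0)) (below_obj T n)"
proof -
  have *: "below_obj T n k k' = rand T (nat_obj k k') (lift (k < n))" for k k'
    by (simp add: below_obj_def sub_obj_def)
  have "k = k' \<and> k < n" if "below_obj T n k k' \<noteq> {}" for k k'
    using that unfolding * rand_nonempty lift_nonempty by (auto simp: nat_obj_def)
  moreover have "rz (pfst t) e {k}" if "rz t e (below_obj T n k k)" for t e k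
    using rz_fst[OF that[unfolded *]] by (simp add: nat_obj_def)
  moreover have "rz (ppair t (const_prog 0)) e (below_obj T n k k)"
    if "rz t e {k}" "k < n" for t e k
    unfolding * using that by (intro rz_pair rz_lift) (simp_all add: nat_obj_def)
  ultimately show ?thesis unfolding tracked_def by blast
qed

end

theorem theorem7p1:
  fixes \<phi> :: "(nat \<Rightarrow> bool) \<Rightarrow> nat \<Rightarrow> nat \<Rightarrow> nat option"
    and pr :: "nat \<Rightarrow> nat \<Rightarrow> nat"
    and q :: "nat \<Rightarrow> rat"
    and \<mu> :: "nat \<Rightarrow> real"
    and T :: "(nat, nat \<Rightarrow> bool) ppca"
  assumes "acceptable_numbering \<phi>"
    and "computable_pairing pr"
    and "computable_rat_enumeration q"
    and "miller_sequence \<phi> pr q \<mu>"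
    and "is_ppca T" and "par T = oracles_of pr \<mu>" and "app T = \<phi>"
  shows "holds T (every_map_has_fixed_point T (exp_obj T nat_obj (unit_interval_obj T q))) \<and>
         holds T (all_in T nat_obj (\<lambda>n.
           every_map_has_fixed_point T (exp_obj T (below_obj T n) (unit_interval_obj T q))))"
proof -
  interpret miller \<phi> T pr q \<mu>
    by unfold_locales (fact assms)+
  obtain t where t: "\<And>e. rz t e (every_map_has_fixed_point T (exp_obj T nat_obj I))"
    using fixed_point_tracked[of "\<lambda>t. t" "\<lambda>t. t"] tracked_nat_obj by blast
  \<comment> \<open>\<open>u\<close> works for every \<open>n\<close> and in every environment, so
    it also realizes the body of the internal quantifier over \<open>n\<close>.\<close>
  obtain u where u: "\<And>n e. rz u e (every_map_has_fixed_point T (exp_obj T (below_obj T n) I))"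
    using fixed_point_tracked[of pfst "\<lambda>t. ppair t (const_prog 0)"] tracked_below_obj by blast
  show ?thesis
    by (intro conjI) (rule holds_if_rz[OF t], rule holds_if_rz[OF rz_all_inI[OF u]])
qed

end
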